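(* The triple $\Gamma=(\mathbf{Hyp},\mathrm{Trees},\{K^n_{\mathbf{Hyp}}\}_{n\ge0})$ is a width category. Furthermore, for every hypergraph $H$, its hypergraph treewidth and its $\Gamma$-width are equal: $\mathbf{tw}_{\mathbf{Hyp}}(H)=\mathbf{w}_\Gamma(H)$.
   Context: Hypergraphs: a hypergraph $H$ is a finite set $V(H)$ of vertices with a set $E(H)$ of nonempty subsets of $V(H)$ (hyperedges); $E_n(H)$ is the set of hyperedges of cardinality $n$. A hypergraph homomorphism $f:H\to H'$ is a function $f:V(H)\to V(H')$ such that $e\in E_n(H)$ implies $f(e)\in E_n(H')$ for every $n$. $\mathbf{Hyp}$ is the resulting category (finite sets are taken from a fixed small skeleton). $K^n_{\mathbf{Hyp}}$ is the hypergraph with vertex set $\{1,\dots,n\}$ in which every nonempty subset is a hyperedge. Graphs are finite and simple. A tree is a nonempty connected graph with no cycles; $\mathrm{Trees}$ is the set of all (finite) trees. For a graph $G$, the category $\int G$ has as objects the vertices and the (unordered) edges of $G$; its only non-identity morphisms are, for each edge $e=xy$, two morphisms $e_x:e\to x$ and $e_y:e\to y$. Structured decompositions: for a set $\mathcal{G}$ of graphs, a $\mathcal{G}$-structured decomposition in a category $\mathcal{C}$ is a functor $d:\int G\to\mathcal{C}$, $G\in\mathcal{G}$, sending every morphism to a monomorphism; the $d(v)$, $v\in V(G)$, are its bags. It is a decomposition of an object $X$ if $X\cong\operatorname{colim} d$. Spined sd-category: a triple $(\mathcal{C},\mathcal{G},\Omega)$ with $\mathcal{C}$ a small category, $\mathcal{G}$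 a set of graphs containing the one-vertex graph, such that (W1) every $\mathcal{G}$-structured decomposition has a colimit in $\mathcal{C}$; and $\Omega=\bigcup_{n\ge0}\Omega_n$ a full subcategory closed under isomorphism, filtered by full subcategories $\Omega_0\subseteq\Omega_1\subseteq\cdots$ closed under isomorphism, such that (W2a) every object admits a monomorphism into some object of $\Omega$; (W2b) for $n\ge1$ and $W\in\Omega_n\setminus\Omega_{n-1}$ there is no monomorphism from $W$ into an object of $\Omega_{n-1}$. The notation $\{K^n_{\mathbf{Hyp}}\}_{n\ge0}$ denotes the spine where $\Omega_n$ consists of the hypergraphs isomorphic to $K^m_{\mathbf{Hyp}}$ for some $m\le n$. Width category: a spined sd-category in which pullbacks of monomorphisms along arbitrary morphisms exist and (W3) for every $\mathcal{G}$-structured decomposition $d$ of an object $Y$ and every monomorphism $f:X\to Y$, the pullback along $f$ of the colimit cocone $(d(i)\to Y)_i$ (objects $X\times_Y d(i)$, with projections to $X$) exists and is a colimit cocone with apex $X$. $\Gamma$-width: $s(X)$ is the smallest $n$ such that there is a monomorphism from $X$ into an object of $\Omega_n$; $w(d)=\max_{x\in V(G)}s(d(x))-1$ for $d:\int G\to\mathcal{C}$; $\mathbf{w}_\Gamma(X)=\min_d w(d)$ over all $\mathcal{G}$-structured decompositions $d$ of $X$. Hypergraph treewidth: an RS-tree decomposition of a hypergraph $H$ is a tree $T$ with a function $X:V(T)\to P(V(H))$ such that (1) $\bigcup_t X(t)=V(H)$; (2) for every $e\in E(H)$ there is $t$ with $e\subseteq X(t)$; (3) if $t_2$ lies on the unique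 path between $t_1$ and $t_3$ then $X(t_1)\cap X(t_3)\subseteq X(t_2)$. Its width is $\max_t|X(t)|-1$, and $\mathbf{tw}_{\mathbf{Hyp}}(H)$ is the minimum width of all RS-tree decompositions of $H$. *)

theory Defs
  imports "HOL-Library.FuncSet"
begin

section \<open>Categories\<close>

text \<open>A category is small because its objects and its morphisms form sets. \<open>Comp C g f\<close> is
  the composite ``\<open>g\<close> after \<open>f\<close>''; it is only meaningful when \<open>Cod C f = Dom C g\<close>.\<close>

record ('o, 'm) cat =
  Obj :: "'o set"
  Arr :: "'m set"
  Dom :: "'m \<Rightarrow> 'o"
  Cod :: "'m \<Rightarrow> 'o"
  Id :: "'o \<Rightarrow> 'm"
  Comp :: "'m \<Rightarrow> 'm \<Rightarrow> 'm"

definition homs :: "('o, 'm) cat \<Rightarrow> 'o \<Rightarrow> 'o \<Rightarrow> 'm set" where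
  "homs C X Y = {f \<in> Arr C. Dom C f = X \<and> Cod C f = Y}"

locale category =
  fixes C :: "('o, 'm) cat"
  assumes dom_in_Obj: "f \<in> Arr C \<Longrightarrow> Dom C f \<in> Obj C"
    and cod_in_Obj: "f \<in> Arr C \<Longrightarrow> Cod C f \<in> Obj C"
    and id_in_homs: "X \<in> Obj C \<Longrightarrow> Id C X \<in> homs C X X"
    and comp_in_homs: "f \<in> homs C X Y \<Longrightarrow> g \<in> homs C Y Z \<Longrightarrow> Comp C g f \<in> homs C X Z"
    and comp_id_right: "f \<in> homs C X Y \<Longrightarrow> Comp C f (Id C X) = f"
    and comp_id_left: "f \<in> homs C X Y \<Longrightarrow> Comp C (Id C Y) f = f"
    and comp_assoc: "f \<in> homs C W X \<Longrightarrow> g \<in> homs C X Y \<Longrightarrow> h \<in> homs C Y Z \<Longrightarrow>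
      Comp C h (Comp C g f) = Comp C (Comp C h g) f"

definition monics :: "('o, 'm) cat \<Rightarrow> 'o \<Rightarrow> 'o \<Rightarrow> 'm set" where
  "monics C X Y = {m \<in> homs C X Y. \<forall>W\<in>Obj C. \<forall>g\<in>homs C W X. \<forall>h\<in>homs C W X.
     Comp C m g = Comp C m h \<longrightarrow> g = h}"

definition iso_objs :: "('o, 'm) cat \<Rightarrow> 'o \<Rightarrow> 'o \<Rightarrow> bool" where
  "iso_objs C X Y \<longleftrightarrow> (\<exists>f\<in>homs C X Y. \<exists>g\<in>homs C Y X.
     Comp C g f = Id C X \<and> Comp C f g = Id C Y)"

record ('o, 'm, 'p, 'n) ftor =
  omap :: "'o \<Rightarrow> 'p"
  amap :: "'m \<Rightarrow> 'n"

definition is_functor :: "('o, 'm) cat \<Rightarrow> ('p, 'n) cat \<Rightarrow> ('o, 'm, 'p, 'n) ftor \<Rightarrow> bool" where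
  "is_functor A B F \<longleftrightarrow>
     (\<forall>X\<in>Obj A. omap F X \<in> Obj B) \<and>
     (\<forall>X\<in>Obj A. \<forall>Y\<in>Obj A. \<forall>f\<in>homs A X Y. amap F f \<in> homs B (omap F X) (omap F Y)) \<and>
     (\<forall>X\<in>Obj A. amap F (Id A X) = Id B (omap F X)) \<and>
     (\<forall>f\<in>Arr A. \<forall>g\<in>Arr A. Cod A f = Dom A g \<longrightarrow>
        amap F (Comp A g f) = Comp B (amap F g) (amap F f))"

definition is_cocone ::
  "('o, 'm) cat \<Rightarrow> ('p, 'n) cat \<Rightarrow> ('o, 'm, 'p, 'n) ftor \<Rightarrow> 'p \<Rightarrow> ('o \<Rightarrow> 'n) \<Rightarrow> bool" where
  "is_cocone J C d Z c \<longleftrightarrow>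
     Z \<in> Obj C \<and>
     (\<forall>i\<in>Obj J. c i \<in> homs C (omap d i) Z) \<and>
     (\<forall>i\<in>Obj J. \<forall>j\<in>Obj J. \<forall>a\<in>homs J i j. Comp C (c j) (amap d a) = c i)"

definition is_colimit ::
  "('o, 'm) cat \<Rightarrow> ('p, 'n) cat \<Rightarrow> ('o, 'm, 'p, 'n) ftor \<Rightarrow> 'p \<Rightarrow> ('o \<Rightarrow> 'n) \<Rightarrow> bool" where
  "is_colimit J C d Z c \<longleftrightarrow>
     is_cocone J C d Z c \<and>
     (\<forall>Z' c'. is_cocone J C d Z' c' \<longrightarrow>
        (\<exists>!u. u \<in> homs C Z Z' \<and> (\<forall>i\<in>Obj J. Comp C u (c i) = c' i)))"

text \<open>\<open>is_pullback C f g P p q\<close>: the square with \<open>p\<close> opposite \<open>g\<close> and \<open>q\<close> opposite \<open>f\<close>,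
  i.e.\ \<open>f p = g q\<close>, is a pullback.\<close>

definition is_pullback ::
  "('o, 'm) cat \<Rightarrow> 'm \<Rightarrow> 'm \<Rightarrow> 'o \<Rightarrow> 'm \<Rightarrow> 'm \<Rightarrow> bool" where
  "is_pullback C f g P p q \<longleftrightarrow>
     f \<in> Arr C \<and> g \<in> Arr C \<and> Cod C f = Cod C g \<and> P \<in> Obj C \<and>
     p \<in> homs C P (Dom C f) \<and> q \<in> homs C P (Dom C g) \<and> Comp C f p = Comp C g q \<and>
     (\<forall>Q\<in>Obj C. \<forall>p'\<in>homs C Q (Dom C f). \<forall>q'\<in>homs C Q (Dom C g).
        Comp C f p' = Comp C g q' \<longrightarrow>
        (\<exists>!u. u \<in> homs C Q P \<and> Comp C p u = p' \<and> Comp C q u = q'))"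


section \<open>Graphs and trees\<close>

text \<open>The tree predicate of the AFP entry \<open>Graph_Theory\<close> does not apply here: it represents an
  undirected graph by a symmetric digraph, in which \<open>a, b, a\<close> counts as a cycle.\<close>

record 'v graph =
  gverts :: "'v set"
  gedges :: "'v set set"

definition simple_graph :: "'v graph \<Rightarrow> bool" where
  "simple_graph G \<longleftrightarrow> finite (gverts G) \<and> (\<forall>e\<in>gedges G. e \<subseteq> gverts G \<and> card e = 2)"

definition is_path :: "'v graph \<Rightarrow> 'v \<Rightarrow> 'v list \<Rightarrow> 'v \<Rightarrow> bool" where
  "is_path G x p y \<longleftrightarrow> p \<noteq> [] \<and> hd p = x \<and> last p = y \<and> set p \<subseteq> gverts G \<and> distinct p \<and>
     successively (\<lambda>u v. {u, v} \<in> gedges G) p"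

definition is_cycle :: "'v graph \<Rightarrow> 'v list \<Rightarrow> bool" where
  "is_cycle G p \<longleftrightarrow> length p \<ge> 3 \<and> set p \<subseteq> gverts G \<and> distinct p \<and>
     successively (\<lambda>u v. {u, v} \<in> gedges G) p \<and> {last p, hd p} \<in> gedges G"

definition is_tree :: "'v graph \<Rightarrow> bool" where
  "is_tree G \<longleftrightarrow> simple_graph G \<and> gverts G \<noteq> {} \<and>
     (\<forall>x\<in>gverts G. \<forall>y\<in>gverts G. \<exists>p. is_path G x p y) \<and> \<not> (\<exists>p. is_cycle G p)"

text \<open>Vertices are natural numbers, which represents every finite tree up to isomorphism.\<close>

definition Trees :: "nat graph set" where
  "Trees = {T. is_tree T}"

text \<open>The category \<open>\<integral>G\<close>: the objects are \<open>Inl x\<close> for vertices \<open>x\<close> and \<open>Inr e\<close> for edges \<open>e\<close>. As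
  there is at most one morphism between any two objects, a morphism is represented by the pair of
  its domain and codomain; \<open>(Inr e, Inl x)\<close> is the morphism \<open>e\<^sub>x\<close>.\<close>

definition elts_cat :: "'v graph \<Rightarrow> ('v + 'v set, ('v + 'v set) \<times> ('v + 'v set)) cat" where
  "elts_cat G =
     \<lparr> Obj = Inl ` gverts G \<union> Inr ` gedges G,
       Arr = {(i, i) | i. i \<in> Inl ` gverts G \<union> Inr ` gedges G} \<union>
             {(Inr e, Inl x) | e x. e \<in> gedges G \<and> x \<in> e},
       Dom = fst, Cod = snd,
       Id = (\<lambda>i. (i, i)),
       Comp = (\<lambda>g f. (fst f, snd g)) \<rparr>"


section \<open>Structured decompositions, spined sd-categories and width categories\<close>

type_synonym ('v, 'o, 'm) sd = "('v + 'v set, ('v + 'v set) \<times> ('v + 'v set), 'o, 'm) ftor"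

definition is_sd :: "('o, 'm) cat \<Rightarrow> 'v graph \<Rightarrow> ('v, 'o, 'm) sd \<Rightarrow> bool" where
  "is_sd C G d \<longleftrightarrow> is_functor (elts_cat G) C d \<and>
     (\<forall>i\<in>Obj (elts_cat G). \<forall>j\<in>Obj (elts_cat G). \<forall>a\<in>homs (elts_cat G) i j.
        amap d a \<in> monics C (omap d i) (omap d j))"

definition is_sd_of :: "('o, 'm) cat \<Rightarrow> 'v graph \<Rightarrow> ('v, 'o, 'm) sd \<Rightarrow> 'o \<Rightarrow> bool" where
  "is_sd_of C G d X \<longleftrightarrow> is_sd C G d \<and>
     (\<exists>Z c. is_colimit (elts_cat G) C d Z c \<and> iso_objs C X Z)"

text \<open>The full subcategories \<open>\<Omega>\<^sub>n\<close> are given by their sets of objects. That their union is closed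
  under isomorphism follows from the same property of each \<open>\<Omega>\<^sub>n\<close>.\<close>

locale spined_sd_category = category C
  for C :: "('o, 'm) cat" +
  fixes \<G> :: "'v graph set" and \<Omega> :: "nat \<Rightarrow> 'o set"
  assumes graphs: "G \<in> \<G> \<Longrightarrow> simple_graph G"
    and one_vertex_graph: "\<exists>G\<in>\<G>. \<exists>x. gverts G = {x} \<and> gedges G = {}"
    and W1: "G \<in> \<G> \<Longrightarrow> is_sd C G d \<Longrightarrow> \<exists>Z c. is_colimit (elts_cat G) C d Z c"
    and spine_subset: "\<Omega> n \<subseteq> Obj C"
    and spine_mono: "\<Omega> n \<subseteq> \<Omega> (Suc n)"
    and spine_iso_closed: "X \<in> \<Omega> n \<Longrightarrow> Y \<in> Obj C \<Longrightarrow> iso_objs C X Y \<Longrightarrow> Y \<in> \<Omega> n"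
    and W2a: "X \<in> Obj C \<Longrightarrow> \<exists>W \<in> (\<Union>n. \<Omega> n). monics C X W \<noteq> {}"
    and W2b: "n \<ge> 1 \<Longrightarrow> W \<in> \<Omega> n - \<Omega> (n - 1) \<Longrightarrow> V \<in> \<Omega> (n - 1) \<Longrightarrow> monics C W V = {}"

text \<open>In \<open>W3\<close>, the objects \<open>P i\<close> with projections \<open>p i\<close> and \<open>q i\<close> are the pullbacks of \<open>f\<close> and
  \<open>c i\<close>. The diagram \<open>d'\<close> formed by the \<open>P i\<close> is the one induced by universality of the pullbacks:
  its morphisms commute with the \<open>q i\<close> by the last condition on \<open>d'\<close>, and with the \<open>p i\<close> as part of
  the cocone property.\<close>

locale width_category = spined_sd_category C \<G> \<Omega>
  for C :: "('o, 'm) cat" and \<G> :: "'v graph set" and \<Omega> :: "nat \<Rightarrow> 'o set" +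
  assumes mono_pullbacks: "m \<in> monics C X Z \<Longrightarrow> g \<in> homs C Y Z \<Longrightarrow> \<exists>P p q. is_pullback C m g P p q"
    and W3: "G \<in> \<G> \<Longrightarrow> is_sd C G d \<Longrightarrow> is_colimit (elts_cat G) C d Y c \<Longrightarrow> f \<in> monics C X Y \<Longrightarrow>
      \<exists>P p q d'.
        (\<forall>i\<in>Obj (elts_cat G). is_pullback C f (c i) (P i) (p i) (q i)) \<and>
        is_functor (elts_cat G) C d' \<and>
        (\<forall>i\<in>Obj (elts_cat G). omap d' i = P i) \<and>
        (\<forall>i\<in>Obj (elts_cat G). \<forall>j\<in>Obj (elts_cat G). \<forall>a\<in>homs (elts_cat G) i j.
           Comp C (q j) (amap d' a) = Comp C (amap d a) (q i)) \<and>
        is_colimit (elts_cat G) C d' X p"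

definition spine_size :: "('o, 'm) cat \<Rightarrow> (nat \<Rightarrow> 'o set) \<Rightarrow> 'o \<Rightarrow> nat" where
  "spine_size C \<Omega> X = (LEAST n. \<exists>W\<in>\<Omega> n. monics C X W \<noteq> {})"

text \<open>Widths are integers: the empty hypergraph has width \<open>-1\<close>.\<close>

definition sd_width ::
  "('o, 'm) cat \<Rightarrow> (nat \<Rightarrow> 'o set) \<Rightarrow> 'v graph \<Rightarrow> ('v, 'o, 'm) sd \<Rightarrow> int" where
  "sd_width C \<Omega> G d = Max ((\<lambda>x. int (spine_size C \<Omega> (omap d (Inl x)))) ` gverts G) - 1"

definition Gamma_width ::
  "('o, 'm) cat \<Rightarrow> 'v graph set \<Rightarrow> (nat \<Rightarrow> 'o set) \<Rightarrow> 'o \<Rightarrow> int" where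
  "Gamma_width C \<G> \<Omega> X = (LEAST k. \<exists>G\<in>\<G>. \<exists>d. is_sd_of C G d X \<and> sd_width C \<Omega> G d = k)"


section \<open>Hypergraphs\<close>

record 'a hypergraph =
  hverts :: "'a set"
  hedges :: "'a set set"

definition is_hypergraph :: "'a hypergraph \<Rightarrow> bool" where
  "is_hypergraph H \<longleftrightarrow> finite (hverts H) \<and> (\<forall>e\<in>hedges H. e \<noteq> {} \<and> e \<subseteq> hverts H)"

definition hedges_card :: "nat \<Rightarrow> 'a hypergraph \<Rightarrow> 'a set set" where
  "hedges_card n H = {e \<in> hedges H. card e = n}"

definition hyp_homs :: "'a hypergraph \<Rightarrow> 'b hypergraph \<Rightarrow> ('a \<Rightarrow> 'b) set" where
  "hyp_homs H H' = {f \<in> hverts H \<rightarrow>\<^sub>E hverts H'.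
     \<forall>n. \<forall>e\<in>hedges_card n H. f ` e \<in> hedges_card n H'}"

text \<open>The skeleton of finite sets underlying \<open>Hyp\<close> consists of the sets \<open>{1..n}\<close>. A morphism is a
  homomorphism together with its domain and codomain.\<close>

definition Hyp :: "(nat hypergraph, nat hypergraph \<times> (nat \<Rightarrow> nat) \<times> nat hypergraph) cat" where
  "Hyp =
     \<lparr> Obj = {H. is_hypergraph H \<and> (\<exists>n. hverts H = {1..n})},
       Arr = {(H, f, H') | H f H'.
                is_hypergraph H \<and> (\<exists>n. hverts H = {1..n}) \<and>
                is_hypergraph H' \<and> (\<exists>n. hverts H' = {1..n}) \<and> f \<in> hyp_homs H H'},
       Dom = (\<lambda>(H, f, H'). H),
       Cod = (\<lambda>(H, f, H'). H'),
       Id = (\<lambda>H. (H, restrict id (hverts H), H)),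
       Comp = (\<lambda>(H', g, H'') (H, f, K). (H, compose (hverts H) g f, H'')) \<rparr>"

definition K_Hyp :: "nat \<Rightarrow> nat hypergraph" where
  "K_Hyp n = \<lparr> hverts = {1..n}, hedges = {e. e \<noteq> {} \<and> e \<subseteq> {1..n}} \<rparr>"

definition Hyp_spine :: "nat \<Rightarrow> nat hypergraph set" where
  "Hyp_spine n = {H \<in> Obj Hyp. \<exists>m\<le>n. iso_objs Hyp H (K_Hyp m)}"

definition RS_tree_decomposition ::
  "'a hypergraph \<Rightarrow> 'v graph \<Rightarrow> ('v \<Rightarrow> 'a set) \<Rightarrow> bool" where
  "RS_tree_decomposition H T X \<longleftrightarrow> is_tree T \<and>
     (\<forall>t\<in>gverts T. X t \<subseteq> hverts H) \<and>
     (\<Union>t\<in>gverts T. X t) = hverts H \<and>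
     (\<forall>e\<in>hedges H. \<exists>t\<in>gverts T. e \<subseteq> X t) \<and>
     (\<forall>t1 t2 t3 p. is_path T t1 p t3 \<and> t2 \<in> set p \<longrightarrow> X t1 \<inter> X t3 \<subseteq> X t2)"

definition RS_width :: "'v graph \<Rightarrow> ('v \<Rightarrow> 'a set) \<Rightarrow> int" where
  "RS_width T X = Max ((\<lambda>t. int (card (X t))) ` gverts T) - 1"

definition tw_Hyp :: "'a hypergraph \<Rightarrow> int" where
  "tw_Hyp H = (LEAST k. \<exists>(T :: nat graph) X. RS_tree_decomposition H T X \<and> RS_width T X = k)"

end

theory Submission
  imports Defs
begin

text \<open>A tree-shaped diagram of monomorphisms of hypergraphs is glued as in sets: the points of the
  bags are identified along the legs. Since the legs are injective, a chain of identifications that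
  never backtracks projects to a non-backtracking walk in the tree, which is a path because the tree
  has no cycles. So no two points of one bag are identified; the bags therefore embed, and the images
  of their hyperedges keep their cardinality, so that the glued hypergraph is the colimit. A cocone is
  a colimit if and only if it covers the vertices, lifts the hyperedges and identifies points only
  along such chains. These three conditions pull back along any homomorphism; when the bags are
  regarded as vertex sets of the colimit, they are the three conditions on a tree decomposition, the
  last one because the path underlying a chain is the unique path of the tree. Hence structured
  decompositions and tree decompositions have the same widths over each tree.\<close>

section \<open>The category of hypergraphs\<close>

text \<open>The obstacle is that \<open>Hyp\<close> lacks many colimits: a homomorphism is injective
  on every hyperedge, so once two vertices of one hyperedge are forced to coincide, the diagram has
  no cocone at all. Hence the embedding of the bags is needed before there is any colimit to speak
  of. A second difficulty is that the colimits in \<open>W3\<close> and in \<open>is_sd_of\<close>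
  are given by their universal property only; they acquire points and chains by comparison with one
  colimit built by hand. Pulling back is then elementwise: all points of a chain have the same image
  in the colimit, so a vertex \<open>x\<close> over that image can be paired with every adhesion
  vertex used by the chain, and the chain lifts. Conversely, the hypergraphs induced on the bags and
  on the intersections of adjacent bags recover the given hypergraph, because each hyperedge lies in
  a bag and the bags containing a given vertex are joined by paths of such bags.\<close>

abbreviation fn :: "'a \<times> 'b \<times> 'c \<Rightarrow> 'b" where
  "fn m \<equiv> fst (snd m)"

lemma hyp_homs_iff:
  "f \<in> hyp_homs H H' \<longleftrightarrow> f \<in> hverts H \<rightarrow>\<^sub>E hverts H' \<and>
     (\<forall>e\<in>hedges H. f ` e \<in> hedges H' \<and> card (f ` e) = card e)"
  unfolding hyp_homs_def hedges_card_def by auto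

lemma Obj_Hyp: "H \<in> Obj Hyp \<longleftrightarrow> is_hypergraph H \<and> (\<exists>n. hverts H = {1..n})"
  by (simp add: Hyp_def)

lemma homs_Hyp_iff:
  "m \<in> homs Hyp X Y \<longleftrightarrow> X \<in> Obj Hyp \<and> Y \<in> Obj Hyp \<and> (\<exists>f\<in>hyp_homs X Y. m = (X, f, Y))"
  unfolding homs_def Hyp_def by auto

lemma Comp_Hyp: "Comp Hyp (H', g, H'') (H, f, K) = (H, compose (hverts H) g f, H'')"
  by (simp add: Hyp_def)

lemma Id_Hyp: "Id Hyp H = (H, restrict id (hverts H), H)"
  by (simp add: Hyp_def)

lemma finite_hverts: "X \<in> Obj Hyp \<Longrightarrow> finite (hverts X)"
  by (auto simp: Obj_Hyp is_hypergraph_def)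

lemma hedges_subset: "X \<in> Obj Hyp \<Longrightarrow> e \<in> hedges X \<Longrightarrow> e \<subseteq> hverts X"
  by (auto simp: Obj_Hyp is_hypergraph_def)

lemma hedges_finite: "X \<in> Obj Hyp \<Longrightarrow> e \<in> hedges X \<Longrightarrow> finite e"
  using finite_subset[OF hedges_subset finite_hverts] .

lemma hedges_nonempty: "X \<in> Obj Hyp \<Longrightarrow> e \<in> hedges X \<Longrightarrow> e \<noteq> {}"
  by (auto simp: Obj_Hyp is_hypergraph_def)

lemma homs_HypD:
  assumes "m \<in> homs Hyp X Y"
  shows "X \<in> Obj Hyp" "Y \<in> Obj Hyp" "x \<in> hverts X \<Longrightarrow> fn m x \<in> hverts Y"
    "e \<in> hedges X \<Longrightarrow> fn m ` e \<in> hedges Y" "e \<in> hedges X \<Longrightarrow> card (fn m ` e) = card e"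
  using assms by (auto simp: homs_Hyp_iff hyp_homs_iff)

text \<open>Keeping the cardinality of a finite set means being injective on it. Injectivity
  composes and restricts, so \<open>homs_HypI\<close> asks for the condition in this form.\<close>

lemma homs_Hyp_inj_on_hedge:
  assumes "m \<in> homs Hyp X Y" "e \<in> hedges X"
  shows "inj_on (fn m) e"
  using assms hedges_finite homs_HypD by (metis eq_card_imp_inj_on)

lemma homs_HypI:
  assumes "X \<in> Obj Hyp" "Y \<in> Obj Hyp" "\<And>x. x \<in> hverts X \<Longrightarrow> f x \<in> hverts Y"
    "\<And>e. e \<in> hedges X \<Longrightarrow> f ` e \<in> hedges Y \<and> inj_on f e"
  shows "(X, restrict f (hverts X), Y) \<in> homs Hyp X Y"
proof -
  have "restrict f (hverts X) ` e = f ` e" if "e \<in> hedges X" for e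
    using hedges_subset[OF assms(1) that] by (intro image_cong) auto
  then show ?thesis
    using assms by (auto simp: homs_Hyp_iff hyp_homs_iff card_image)
qed

lemma homs_Hyp_eqI:
  assumes "m \<in> homs Hyp X Y" "m' \<in> homs Hyp X Y" "\<And>x. x \<in> hverts X \<Longrightarrow> fn m x = fn m' x"
  shows "m = m'"
proof -
  obtain f f' where "f \<in> hverts X \<rightarrow>\<^sub>E hverts Y" "f' \<in> hverts X \<rightarrow>\<^sub>E hverts Y"
    and m: "m = (X, f, Y)" "m' = (X, f', Y)"
    using assms(1,2) by (auto simp: homs_Hyp_iff hyp_homs_iff)
  moreover from this have "f x = f' x" if "x \<in> hverts X" for x
    using assms(3)[OF that] by simp
  ultimately show ?thesis
    by (metis PiE_ext)
qed

lemma fn_Comp: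
  assumes "m \<in> homs Hyp X Y" "x \<in> hverts X"
  shows "fn (Comp Hyp m' m) x = fn m' (fn m x)"
  using assms by (cases m') (auto simp: homs_Hyp_iff Comp_Hyp compose_def)

lemma fn_Id: "x \<in> hverts X \<Longrightarrow> fn (Id Hyp X) x = x"
  by (simp add: Id_Hyp)

lemma id_in_homs_Hyp: "X \<in> Obj Hyp \<Longrightarrow> Id Hyp X \<in> homs Hyp X X"
  unfolding Id_Hyp by (intro homs_HypI) auto

lemma comp_in_homs_Hyp:
  assumes "f \<in> homs Hyp X Y" "g \<in> homs Hyp Y Z"
  shows "Comp Hyp g f \<in> homs Hyp X Z"
proof -
  have "Comp Hyp g f = (X, restrict (\<lambda>x. fn g (fn f x)) (hverts X), Z)"
    using assms by (auto simp: homs_Hyp_iff Comp_Hyp compose_def)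
  moreover have "inj_on (fn g \<circ> fn f) e" if "e \<in> hedges X" for e
    using that assms homs_HypD(4) by (blast intro: comp_inj_on homs_Hyp_inj_on_hedge)
  moreover have "(\<lambda>x. fn g (fn f x)) ` e \<in> hedges Z" if "e \<in> hedges X" for e
    using homs_HypD(4)[OF assms(2) homs_HypD(4)[OF assms(1) that]] by (simp add: image_image)
  ultimately show ?thesis
    using assms by (auto simp: comp_def intro!: homs_HypI dest: homs_HypD)
qed

lemma category_Hyp: "category Hyp"
proof
  fix f assume "f \<in> Arr Hyp"
  then show "Dom Hyp f \<in> Obj Hyp" "Cod Hyp f \<in> Obj Hyp"
    by (auto simp: Hyp_def)
next
  fix f X Y assume f: "f \<in> homs Hyp X Y"
  show "Comp Hyp f (Id Hyp X) = f" "Comp Hyp (Id Hyp Y) f = f"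
    using homs_HypD(3)[OF f]
    by (auto intro!: homs_Hyp_eqI[OF comp_in_homs_Hyp f] f id_in_homs_Hyp homs_HypD(1,2)[OF f]
        simp: fn_Comp[OF id_in_homs_Hyp[OF homs_HypD(1)[OF f]]] fn_Comp[OF f] fn_Id)
next
  fix f g h W X Y Z assume *: "f \<in> homs Hyp W X" "g \<in> homs Hyp X Y" "h \<in> homs Hyp Y Z"
  show "Comp Hyp h (Comp Hyp g f) = Comp Hyp (Comp Hyp h g) f"
  proof (rule homs_Hyp_eqI)
    show "Comp Hyp h (Comp Hyp g f) \<in> homs Hyp W Z" "Comp Hyp (Comp Hyp h g) f \<in> homs Hyp W Z"
      using * comp_in_homs_Hyp by blast+
  qed (use homs_HypD(3)[OF *(1)] in \<open>auto simp: fn_Comp[OF comp_in_homs_Hyp[OF *(1,2)]] fn_Comp[OF *(1)] fn_Comp[OF *(2)]\<close>)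
qed (fact id_in_homs_Hyp comp_in_homs_Hyp)+

interpretation Hyp: category Hyp
  by (rule category_Hyp)

lemma monics_Hyp_iff: "m \<in> monics Hyp X Y \<longleftrightarrow> m \<in> homs Hyp X Y \<and> inj_on (fn m) (hverts X)"
proof (intro iffI conjI)
  assume m: "m \<in> monics Hyp X Y"
  then show mh: "m \<in> homs Hyp X Y"
    by (simp add: monics_def)
  \<comment> \<open>With no hyperedge, not even {1}, \<open>W\<close> can be mapped to any vertex of
    \<open>X\<close>; the morphisms \<open>p z\<close> below play the role of the elements of
    \<open>X\<close>.\<close>
  define W :: "nat hypergraph" where "W = \<lparr>hverts = {1..1}, hedges = {}\<rparr>"
  have W: "W \<in> Obj Hyp"
    unfolding Obj_Hyp W_def by (auto simp: is_hypergraph_def)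
  show "inj_on (fn m) (hverts X)"
  proof (rule inj_onI)
    fix x y assume xy: "x \<in> hverts X" "y \<in> hverts X" "fn m x = fn m y"
    define p where "p z = (W, restrict (\<lambda>_::nat. z) (hverts W), X)" for z :: nat
    have p: "p z \<in> homs Hyp W X" if "z \<in> hverts X" for z
      unfolding p_def using W homs_HypD[OF mh] that by (intro homs_HypI) (auto simp: W_def)
    have "Comp Hyp m (p x) = Comp Hyp m (p y)"
    proof (rule homs_Hyp_eqI)
      fix w assume w: "w \<in> hverts W"
      have "fn (Comp Hyp m (p z)) w = fn m z" if "z \<in> hverts X" for z
        using w fn_Comp[OF p[OF that] w] by (simp add: p_def)
      with xy show "fn (Comp Hyp m (p x)) w = fn (Comp Hyp m (p y)) w"
        by simp
    qed (use p xy comp_in_homs_Hyp mh in blast)+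
    with m W p xy have "p x = p y"
      unfolding monics_def by blast
    then show "x = y"
      unfolding p_def W_def by (auto dest: fun_cong[of _ _ "1::nat"])
  qed
next
  assume m: "m \<in> homs Hyp X Y \<and> inj_on (fn m) (hverts X)"
  have "g = h" if gh: "g \<in> homs Hyp W X" "h \<in> homs Hyp W X" "Comp Hyp m g = Comp Hyp m h" for W g h
  proof (rule homs_Hyp_eqI[OF gh(1,2)])
    fix w assume w: "w \<in> hverts W"
    have "fn m (fn g w) = fn m (fn h w)"
      using gh(3) fn_Comp[OF gh(1) w, of m] fn_Comp[OF gh(2) w, of m] by simp
    with w show "fn g w = fn h w"
      using m homs_HypD(3)[OF gh(1) w] homs_HypD(3)[OF gh(2) w] by (auto dest: inj_onD)
  qed
  with m show "m \<in> monics Hyp X Y"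
    unfolding monics_def by blast
qed

section \<open>Complete hypergraphs and the spine\<close>

lemma K_Hyp_Obj: "K_Hyp n \<in> Obj Hyp"
  by (auto simp: K_Hyp_def Obj_Hyp is_hypergraph_def)

lemma iso_objs_refl: "X \<in> Obj Hyp \<Longrightarrow> iso_objs Hyp X X"
  unfolding iso_objs_def using Hyp.id_in_homs Hyp.comp_id_left by blast

text \<open>The skeleton has one vertex set for each cardinality, and completeness leaves no choice
  of hyperedges. So closing the spine under isomorphism adds nothing.\<close>

lemma iso_objs_K_Hyp:
  assumes H: "H \<in> Obj Hyp" and iso: "iso_objs Hyp H (K_Hyp m)"
  shows "H = K_Hyp m"
proof -
  obtain f g where f: "f \<in> homs Hyp H (K_Hyp m)" and g: "g \<in> homs Hyp (K_Hyp m) H"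
    and gf: "Comp Hyp g f = Id Hyp H" and fg: "Comp Hyp f g = Id Hyp (K_Hyp m)"
    using iso unfolding iso_objs_def by blast
  have gf': "fn g (fn f x) = x" if "x \<in> hverts H" for x
    using that fn_Comp[OF f that, of g] gf by (simp add: fn_Id)
  have fg': "fn f (fn g x) = x" if "x \<in> hverts (K_Hyp m)" for x
    using that fn_Comp[OF g that, of f] fg by (simp add: fn_Id)
  have "bij_betw (fn f) (hverts H) (hverts (K_Hyp m))"
    using f g gf' fg' by (intro bij_betw_byWitness[of _ "fn g"]) (auto dest: homs_HypD)
  then have "card (hverts H) = m"
    by (simp add: bij_betw_same_card K_Hyp_def)
  moreover obtain n where "hverts H = {1..n}"
    using H unfolding Obj_Hyp by blast
  ultimately have V: "hverts H = {1..m}"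
    by simp
  have "e \<in> hedges H" if "e \<noteq> {}" "e \<subseteq> {1..m}" for e
  proof -
    have "fn f ` e \<subseteq> hverts (K_Hyp m)"
      using that(2) V homs_HypD(3)[OF f] by blast
    with that(1) have "fn f ` e \<in> hedges (K_Hyp m)"
      by (simp add: K_Hyp_def)
    then have "fn g ` fn f ` e \<in> hedges H"
      by (rule homs_HypD(4)[OF g])
    moreover have "fn g ` fn f ` e = (\<lambda>x. x) ` e"
      unfolding image_image using gf' that(2) V by (intro image_cong refl) auto
    ultimately show ?thesis by simp
  qed
  then have "hedges H = {e. e \<noteq> {} \<and> e \<subseteq> {1..m}}"
    using V hedges_subset[OF H] hedges_nonempty[OF H] by blast
  with V show ?thesis
    unfolding K_Hyp_def by simp
qed

lemma Hyp_spine_eq: "Hyp_spine n = K_Hyp ` {..n}"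
  unfolding Hyp_spine_def using iso_objs_K_Hyp iso_objs_refl K_Hyp_Obj by blast

text \<open>An injection of vertices into \<open>K_Hyp m\<close> is already a homomorphism, so only
  the number of vertices counts; in the skeleton the inclusion of initial segments serves.\<close>

lemma monics_K_Hyp:
  assumes X: "X \<in> Obj Hyp"
  shows "monics Hyp X (K_Hyp m) \<noteq> {} \<longleftrightarrow> card (hverts X) \<le> m"
proof
  assume "monics Hyp X (K_Hyp m) \<noteq> {}"
  then obtain i where "i \<in> homs Hyp X (K_Hyp m)" "inj_on (fn i) (hverts X)"
    by (auto simp: monics_Hyp_iff)
  then have "card (hverts X) \<le> card (hverts (K_Hyp m))"
    by (intro card_inj_on_le) (auto dest: homs_HypD simp: K_Hyp_def)
  then show "card (hverts X) \<le> m"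
    by (simp add: K_Hyp_def)
next
  assume le: "card (hverts X) \<le> m"
  have "hverts X \<subseteq> {1..m}"
    using X le by (auto simp: Obj_Hyp)
  then have "(X, restrict id (hverts X), K_Hyp m) \<in> homs Hyp X (K_Hyp m)"
    using X K_Hyp_Obj hedges_subset[OF X] hedges_nonempty[OF X]
    by (intro homs_HypI) (auto simp: K_Hyp_def)
  then have "(X, restrict id (hverts X), K_Hyp m) \<in> monics Hyp X (K_Hyp m)"
    by (auto simp: monics_Hyp_iff inj_on_def)
  then show "monics Hyp X (K_Hyp m) \<noteq> {}" by blast
qed

lemma spine_size_Hyp:
  assumes X: "X \<in> Obj Hyp"
  shows "spine_size Hyp Hyp_spine X = card (hverts X)"
  unfolding spine_size_def Hyp_spine_eq
  by (rule Least_equality) (use monics_K_Hyp[OF X] le_trans in auto)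

section \<open>Walks in forests\<close>

fun no_backtrack :: "'a list \<Rightarrow> bool" where
  "no_backtrack (x # y # z # ws) \<longleftrightarrow> x \<noteq> z \<and> no_backtrack (y # z # ws)"
| "no_backtrack _ \<longleftrightarrow> True"

lemma no_backtrack_Cons: "no_backtrack (x # ws) \<Longrightarrow> no_backtrack ws"
  by (cases ws rule: no_backtrack.cases) auto

text \<open>The condition concerns three consecutive entries, so lists that overlap in two entries
  can be joined; an overlap of one entry would leave the turn at the joint unchecked.\<close>

lemma no_backtrack_append_Cons2:
  "no_backtrack (us @ [x, y]) \<Longrightarrow> no_backtrack (x # y # ws) \<Longrightarrow> no_backtrack (us @ x # y # ws)"
proof (induction us)
  case (Cons a us)
  then show ?case
    by (cases us rule: no_backtrack.cases) auto
qed auto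

lemma distinct_imp_no_backtrack: "distinct ws \<Longrightarrow> no_backtrack ws"
  by (induction ws rule: no_backtrack.induct) auto

definition is_walk :: "'v graph \<Rightarrow> 'v list \<Rightarrow> bool" where
  "is_walk G ws \<longleftrightarrow> set ws \<subseteq> gverts G \<and> successively (\<lambda>u v. {u, v} \<in> gedges G) ws"

text \<open>By induction only the first vertex can be repeated, and the stretch up to its return is
  then a cycle.\<close>

lemma acyclic_no_backtrack_distinct:
  assumes G: "simple_graph G" "\<nexists>p. is_cycle G p"
  shows "is_walk G ws \<Longrightarrow> no_backtrack ws \<Longrightarrow> distinct ws"
proof (induction ws)
  case (Cons a ws)
  have dist: "distinct ws"
    using Cons no_backtrack_Cons[OF Cons.prems(2)] by (auto simp: is_walk_def successively_Cons)
  have False if mem: "a \<in> set ws"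
  proof -
    obtain us vs where ws: "ws = us @ a # vs"
      using mem by (meson split_list)
    \<comment> \<open>\<open>is_cycle\<close> asks for three vertices: an immediate return to
      \<open>a\<close> would be a loop, which a simple graph excludes, and a return after one vertex
      would be a backtrack.\<close>
    have "us \<noteq> []"
      using Cons.prems(1) G(1) by (force simp: ws is_walk_def simple_graph_def)
    moreover have "length us \<noteq> 1"
      using Cons.prems(2) by (auto simp: ws length_Suc_conv)
    ultimately have "length us \<ge> 2"
      by (cases us) (auto simp: Suc_le_eq)
    moreover have "successively (\<lambda>u v. {u, v} \<in> gedges G) ((a # us) @ a # vs)"
      using Cons.prems(1) by (simp add: is_walk_def ws)
    then have "successively (\<lambda>u v. {u, v} \<in> gedges G) (a # us)" "{last (a # us), a} \<in> gedges G"
      unfolding successively_append_iff by auto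
    ultimately have "is_cycle G (a # us)"
      using dist Cons.prems(1) by (auto simp: is_cycle_def ws is_walk_def)
    then show False
      using G(2) by blast
  qed
  with dist show ?case by auto
qed auto

text \<open>If two paths part ways at a vertex, then running back along one of them and out along the
  other is a closed walk without backtracking.\<close>

lemma acyclic_path_unique:
  assumes G: "simple_graph G" "\<nexists>p. is_cycle G p"
  shows "is_path G x p y \<Longrightarrow> is_path G x q y \<Longrightarrow> p = q"
proof (induction p arbitrary: x q)
  case Nil
  then show ?case by (simp add: is_path_def)
next
  case (Cons a p)
  have a: "a = x"
    using Cons.prems by (simp add: is_path_def)
  obtain q' where q: "q = x # q'"
    using Cons.prems by (cases q) (auto simp: is_path_def)
  show ?case
  proof (cases "p = [] \<or> q' = []")
    case True
    then show ?thesis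
      using Cons.prems by (auto simp: is_path_def a q split: if_splits)
  next
    case False
    then obtain u p2 v q2 where p2: "p = u # p2" and q2: "q' = v # q2"
      by (meson neq_Nil_conv)
    show ?thesis
    proof (cases "u = v")
      case True
      have "p = q'"
        using Cons.prems by (intro Cons.IH[of u]) (auto simp: is_path_def a q p2 q2 True)
      then show ?thesis
        by (simp add: a q)
    next
      case False
      have "is_walk G (rev p2 @ u # x # v # q2)"
        using Cons.prems
        by (auto simp: is_path_def is_walk_def a q p2 q2 successively_append_iff successively_Cons
            insert_commute last_rev neq_Nil_conv)
      moreover have "no_backtrack (rev p2 @ u # x # v # q2)"
      proof (rule no_backtrack_append_Cons2)
        show "no_backtrack (rev p2 @ [u, x])"
          using Cons.prems by (intro distinct_imp_no_backtrack) (auto simp: is_path_def a p2)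
        show "no_backtrack (u # x # v # q2)"
          using Cons.prems False
          by (auto simp: is_path_def q q2 intro!: distinct_imp_no_backtrack)
      qed
      ultimately have "distinct (rev p2 @ u # x # v # q2)"
        by (rule acyclic_no_backtrack_distinct[OF G])
      moreover have "y \<in> set (u # p2)" "y \<in> set (v # q2)"
        using Cons.prems last_in_set unfolding is_path_def a q p2 q2
        by (metis last_ConsR list.distinct(1))+
      ultimately show ?thesis
        by auto
    qed
  qed
qed

section \<open>Colimits of hypergraphs\<close>

lemma Obj_elts_cat [simp]:
  "Inl x \<in> Obj (elts_cat G) \<longleftrightarrow> x \<in> gverts G" "Inr e \<in> Obj (elts_cat G) \<longleftrightarrow> e \<in> gedges G"
  by (auto simp: elts_cat_def)

lemma homs_elts_cat:
  assumes "simple_graph G"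
  shows "a \<in> homs (elts_cat G) i j \<longleftrightarrow> a = (i, j) \<and> i \<in> Obj (elts_cat G) \<and> j \<in> Obj (elts_cat G) \<and>
    (i = j \<or> (\<exists>e x. i = Inr e \<and> j = Inl x \<and> x \<in> e))"
  using assms by (auto simp: homs_def elts_cat_def simple_graph_def) blast

lemma category_elts_cat:
  assumes "simple_graph G"
  shows "category (elts_cat G)"
  by unfold_locales
    (use assms in \<open>auto simp: homs_elts_cat, auto simp: elts_cat_def simple_graph_def\<close>)

text \<open>Besides decompositions, this setting covers the diagrams of pullbacks in
  \<open>W3\<close>, which are obtained as functors. Trees and monic legs enter with
  \<open>hyp_tree_decomposition\<close>.\<close>

locale hyp_diagram =
  fixes G :: "'v graph"
    and d :: "('v, nat hypergraph, nat hypergraph \<times> (nat \<Rightarrow> nat) \<times> nat hypergraph) sd"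
  assumes simple: "simple_graph G" and ftor: "is_functor (elts_cat G) Hyp d"
begin

abbreviation bag :: "'v \<Rightarrow> nat hypergraph" where
  "bag t \<equiv> omap d (Inl t)"

abbreviation adh :: "'v set \<Rightarrow> nat hypergraph" where
  "adh e \<equiv> omap d (Inr e)"

abbreviation leg :: "'v set \<Rightarrow> 'v \<Rightarrow> nat \<Rightarrow> nat" where
  "leg e x \<equiv> fn (amap d (Inr e, Inl x))"

abbreviation cocone where
  "cocone \<equiv> is_cocone (elts_cat G) Hyp d"

lemma edge_in_verts: "e \<in> gedges G \<Longrightarrow> x \<in> e \<Longrightarrow> x \<in> gverts G"
  using simple by (auto simp: simple_graph_def)

lemma edge_nonempty: "e \<in> gedges G \<Longrightarrow> \<exists>x. x \<in> e"
  using simple unfolding simple_graph_def by (metis card.empty ex_in_conv zero_neq_numeral)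

lemma omap_Obj: "i \<in> Obj (elts_cat G) \<Longrightarrow> omap d i \<in> Obj Hyp"
  using ftor by (auto simp: is_functor_def)

lemma leg_homs:
  assumes "e \<in> gedges G" "x \<in> e"
  shows "amap d (Inr e, Inl x) \<in> homs Hyp (adh e) (bag x)"
  using ftor assms edge_in_verts[OF assms]
  by (auto simp: is_functor_def homs_elts_cat[OF simple])

lemma amap_id: "i \<in> Obj (elts_cat G) \<Longrightarrow> amap d (i, i) = Id Hyp (omap d i)"
  using ftor unfolding is_functor_def by (auto simp: elts_cat_def)

lemma cocone_homs: "cocone Z c \<Longrightarrow> i \<in> Obj (elts_cat G) \<Longrightarrow> c i \<in> homs Hyp (omap d i) Z"
  by (simp add: is_cocone_def)

lemma cocone_leg:
  assumes c: "cocone Z c" and e: "e \<in> gedges G" "x \<in> e" and \<alpha>: "\<alpha> \<in> hverts (adh e)"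
  shows "fn (c (Inl x)) (leg e x \<alpha>) = fn (c (Inr e)) \<alpha>"
proof -
  have "Comp Hyp (c (Inl x)) (amap d (Inr e, Inl x)) = c (Inr e)"
    using c e edge_in_verts[OF e] by (auto simp: is_cocone_def homs_elts_cat[OF simple])
  then show ?thesis
    using fn_Comp[OF leg_homs[OF e] \<alpha>] by metis
qed

lemma coconeI:
  assumes Z: "Z \<in> Obj Hyp" and c: "\<And>i. i \<in> Obj (elts_cat G) \<Longrightarrow> c i \<in> homs Hyp (omap d i) Z"
    and eq: "\<And>e x \<alpha>. e \<in> gedges G \<Longrightarrow> x \<in> e \<Longrightarrow> \<alpha> \<in> hverts (adh e) \<Longrightarrow>
      fn (c (Inl x)) (leg e x \<alpha>) = fn (c (Inr e)) \<alpha>"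
  shows "cocone Z c"
  unfolding is_cocone_def
proof (intro conjI ballI)
  fix i j a
  assume i: "i \<in> Obj (elts_cat G)" and "a \<in> homs (elts_cat G) i j"
  then have a: "a = (i, j)" and "i = j \<or> (\<exists>e x. i = Inr e \<and> j = Inl x \<and> e \<in> gedges G \<and> x \<in> e)"
    by (auto simp: homs_elts_cat[OF simple])
  then consider "i = j" | e x where "i = Inr e" "j = Inl x" "e \<in> gedges G" "x \<in> e"
    by blast
  then show "Comp Hyp (c j) (amap d a) = c i"
  proof cases
    case 1
    then show ?thesis
      using i a Hyp.comp_id_right[OF c[OF i]] by (simp add: amap_id)
  next
    case 2
    have x: "Inl x \<in> Obj (elts_cat G)"
      using 2 edge_in_verts by simp
    show ?thesis
      unfolding a 2(1,2)
    proof (rule homs_Hyp_eqI)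
      show "Comp Hyp (c (Inl x)) (amap d (Inr e, Inl x)) \<in> homs Hyp (adh e) Z"
        using leg_homs[OF 2(3,4)] c[OF x] by (rule comp_in_homs_Hyp)
      show "c (Inr e) \<in> homs Hyp (adh e) Z"
        using c 2(3) by simp
    qed (simp add: fn_Comp[OF leg_homs[OF 2(3,4)]] eq 2)
  qed
qed (use Z c in auto)

section \<open>Gluing the bags as sets\<close>

definition points :: "('v \<times> nat) set" where
  "points = (SIGMA t:gverts G. hverts (bag t))"

text \<open>One elementary identification. The relation is symmetric, so its reflexive transitive
  closure is the equivalence relation that defines the colimit in sets; keeping the single steps
  visible lets chains be projected to walks in the graph.\<close>

definition glue :: "'v \<times> nat \<Rightarrow> 'v \<times> nat \<Rightarrow> bool" where
  "glue P Q \<longleftrightarrow> {fst P, fst Q} \<in> gedges G \<and> (\<exists>\<alpha>\<in>hverts (adh {fst P, fst Q}).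
     snd P = leg {fst P, fst Q} (fst P) \<alpha> \<and> snd Q = leg {fst P, fst Q} (fst Q) \<alpha>)"

text \<open>The colimits of tree-shaped diagrams of monomorphisms are computed as in sets, and carry the
  images of the hyperedges of the bags.\<close>

definition glued_cocone where
  "glued_cocone Z c \<longleftrightarrow> cocone Z c \<and>
     hverts Z \<subseteq> (\<Union>t\<in>gverts G. fn (c (Inl t)) ` hverts (bag t)) \<and>
     hedges Z \<subseteq> (\<Union>t\<in>gverts G. (`) (fn (c (Inl t))) ` hedges (bag t)) \<and>
     (\<forall>P\<in>points. \<forall>Q\<in>points. fn (c (Inl (fst P))) (snd P) = fn (c (Inl (fst Q))) (snd Q) \<longrightarrow>
       glue\<^sup>*\<^sup>* P Q)"

lemma glued_cocone_glue:
  assumes "glued_cocone Z c" "P \<in> points" "Q \<in> points"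
    "fn (c (Inl (fst P))) (snd P) = fn (c (Inl (fst Q))) (snd Q)"
  shows "glue\<^sup>*\<^sup>* P Q"
  using assms by (simp add: glued_cocone_def)

text \<open>The opposite inclusion to the last clause of \<open>glued_cocone\<close>: commuting with
  the legs forces every cocone to respect each single gluing.\<close>

lemma glue_cocone_eq:
  assumes c: "cocone Z c" and PQ: "glue\<^sup>*\<^sup>* P Q"
  shows "fn (c (Inl (fst P))) (snd P) = fn (c (Inl (fst Q))) (snd Q)"
  using PQ
proof induction
  case (step Q R)
  then obtain \<alpha> where "{fst Q, fst R} \<in> gedges G" "\<alpha> \<in> hverts (adh {fst Q, fst R})"
    "snd Q = leg {fst Q, fst R} (fst Q) \<alpha>" "snd R = leg {fst Q, fst R} (fst R) \<alpha>"
    unfolding glue_def by blast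
  with step cocone_leg[OF c, of "{fst Q, fst R}"] show ?case
    by simp
qed simp

lemma symp_glue: "symp glue"
  by (rule sympI) (auto simp: glue_def insert_commute)

text \<open>The covering of the vertices makes the mediating map unique, the chains make it well
  defined, and the lifting of hyperedges makes it a homomorphism.\<close>

lemma glued_cocone_is_colimit:
  assumes gl: "glued_cocone Z c"
  shows "is_colimit (elts_cat G) Hyp d Z c"
  unfolding is_colimit_def
proof (intro conjI allI impI)
  show c: "cocone Z c"
    using gl by (simp add: glued_cocone_def)
  fix Z' c' assume c': "cocone Z' c'"
  \<comment> \<open>\<open>r\<close> chooses a preimage of each vertex in some bag, and
    \<open>u\<close> is \<open>c'\<close> on the chosen preimage. Any other preimage is joined to it
    by a chain, which \<open>c'\<close> respects, so the choice does not matter.\<close>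
  have "\<forall>z\<in>hverts Z. \<exists>P\<in>points. fn (c (Inl (fst P))) (snd P) = z"
    using gl by (fastforce simp: glued_cocone_def points_def)
  then obtain r where r: "\<And>z. z \<in> hverts Z \<Longrightarrow> r z \<in> points"
    "\<And>z. z \<in> hverts Z \<Longrightarrow> fn (c (Inl (fst (r z)))) (snd (r z)) = z"
    by metis
  define u where "u z = fn (c' (Inl (fst (r z)))) (snd (r z))" for z
  define m where "m = (Z, restrict u (hverts Z), Z')"
  have cv: "fn (c i) a \<in> hverts Z" if "i \<in> Obj (elts_cat G)" "a \<in> hverts (omap d i)" for i a
    using that homs_HypD(3)[OF cocone_homs[OF c]] by blast
  have u_vert: "u (fn (c (Inl t)) a) = fn (c' (Inl t)) a"
    if "t \<in> gverts G" "a \<in> hverts (bag t)" for t a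
  proof -
    have "fn (c (Inl t)) a \<in> hverts Z"
      using that cv by simp
    moreover have "(t, a) \<in> points"
      using that by (simp add: points_def)
    ultimately have "glue\<^sup>*\<^sup>* (r (fn (c (Inl t)) a)) (t, a)"
      using gl r unfolding glued_cocone_def by simp
    from glue_cocone_eq[OF c' this] show ?thesis
      by (simp add: u_def)
  qed
  have u_all: "u (fn (c i) a) = fn (c' i) a"
    if i: "i \<in> Obj (elts_cat G)" and a: "a \<in> hverts (omap d i)" for i a
  proof (cases i)
    case (Inl t)
    then show ?thesis
      using u_vert i a by simp
  next
    case (Inr e)
    with i obtain x where e: "e \<in> gedges G" "x \<in> e"
      using edge_nonempty by auto
    have a': "a \<in> hverts (adh e)"
      using a Inr by simp
    have "u (fn (c (Inl x)) (leg e x a)) = fn (c' (Inl x)) (leg e x a)"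
      using e edge_in_verts homs_HypD(3)[OF leg_homs[OF e] a'] by (intro u_vert) auto
    then show ?thesis
      using cocone_leg[OF c e a'] cocone_leg[OF c' e a'] Inr by simp
  qed
  have m: "m \<in> homs Hyp Z Z'"
    unfolding m_def
  proof (rule homs_HypI)
    show "Z \<in> Obj Hyp" "Z' \<in> Obj Hyp"
      using c c' by (auto simp: is_cocone_def)
    show "u z \<in> hverts Z'" if "z \<in> hverts Z" for z
      using r(1)[OF that] homs_HypD(3)[OF cocone_homs[OF c']] by (auto simp: u_def points_def)
    show "u ` e \<in> hedges Z' \<and> inj_on u e" if "e \<in> hedges Z" for e
    proof -
      have "e \<in> (\<Union>t\<in>gverts G. (`) (fn (c (Inl t))) ` hedges (bag t))"
        using gl that unfolding glued_cocone_def by blast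
      then obtain t e' where t: "t \<in> gverts G" and e': "e' \<in> hedges (bag t)"
        and e: "e = fn (c (Inl t)) ` e'"
        by blast
      have ct': "c' (Inl t) \<in> homs Hyp (bag t) Z'"
        using cocone_homs[OF c'] t by simp
      have eq: "u (fn (c (Inl t)) a) = fn (c' (Inl t)) a" if "a \<in> e'" for a
        using u_vert[OF t] that hedges_subset[OF homs_HypD(1)[OF ct'] e'] by auto
      have "u ` e = fn (c' (Inl t)) ` e'"
        unfolding e image_image using eq by simp
      \<comment> \<open>On \<open>e'\<close> the composite agrees with \<open>c' (Inl t)\<close>,
        which is injective on the hyperedge \<open>e'\<close> of the bag; hence \<open>u\<close> is
        injective on the image \<open>e\<close>.\<close>
      moreover have "inj_on (u \<circ> fn (c (Inl t))) e'"
        using homs_Hyp_inj_on_hedge[OF ct' e'] eq by (auto simp: inj_on_def)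
      ultimately show ?thesis
        using homs_HypD(4)[OF ct' e'] inj_on_imageI e by metis
    qed
  qed
  show "\<exists>!u. u \<in> homs Hyp Z Z' \<and> (\<forall>i\<in>Obj (elts_cat G). Comp Hyp u (c i) = c' i)"
  proof (rule ex1I[of _ m], intro conjI ballI)
    fix i assume i: "i \<in> Obj (elts_cat G)"
    show "Comp Hyp m (c i) = c' i"
    proof (rule homs_Hyp_eqI)
      show "Comp Hyp m (c i) \<in> homs Hyp (omap d i) Z'"
        using cocone_homs[OF c i] m by (rule comp_in_homs_Hyp)
      show "c' i \<in> homs Hyp (omap d i) Z'"
        using cocone_homs[OF c' i] .
      fix a assume "a \<in> hverts (omap d i)"
      then show "fn (Comp Hyp m (c i)) a = fn (c' i) a"
        using fn_Comp[OF cocone_homs[OF c i]] cv u_all i by (simp add: m_def)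
    qed
  next
    fix u' assume u': "u' \<in> homs Hyp Z Z' \<and> (\<forall>i\<in>Obj (elts_cat G). Comp Hyp u' (c i) = c' i)"
    show "u' = m"
    proof (rule homs_Hyp_eqI)
      fix z assume z: "z \<in> hverts Z"
      have t: "Inl (fst (r z)) \<in> Obj (elts_cat G)" and a: "snd (r z) \<in> hverts (bag (fst (r z)))"
        using r(1)[OF z] by (auto simp: points_def)
      have "fn u' z = fn (c' (Inl (fst (r z)))) (snd (r z))"
        using u' t fn_Comp[OF cocone_homs[OF c t] a, of u'] r(2)[OF z] by simp
      then show "fn u' z = fn m z"
        by (simp add: m_def z u_def)
    qed (use u' m in auto)
  qed (fact m)
qed

text \<open>Vertices and hyperedges are carried to \<open>Z\<^sub>0\<close> by \<open>v\<close>,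
  lifted to a bag there and brought back by \<open>u\<close>; points identified by \<open>c\<close>
  are identified by \<open>c\<^sub>0\<close>, since \<open>v\<close> maps the one cocone to the
  other. This serves both for comparing colimits and for moving a cocone along an
  isomorphism.\<close>

lemma glued_cocone_retract:
  assumes gl: "glued_cocone Z\<^sub>0 c\<^sub>0" and c: "cocone Z c"
    and v: "v \<in> homs Hyp Z Z\<^sub>0" "\<And>i. i \<in> Obj (elts_cat G) \<Longrightarrow> Comp Hyp v (c i) = c\<^sub>0 i"
    and u: "u \<in> homs Hyp Z\<^sub>0 Z" "Comp Hyp u v = Id Hyp Z"
  shows "glued_cocone Z c"
proof -
  have uv: "fn u (fn v z) = z" if "z \<in> hverts Z" for z
    using fn_Comp[OF v(1) that, of u] u(2) that by (simp add: fn_Id)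
  have vc: "fn v (fn (c (Inl t)) a) = fn (c\<^sub>0 (Inl t)) a" if "t \<in> gverts G" "a \<in> hverts (bag t)" for t a
    using fn_Comp[OF cocone_homs[OF c, of "Inl t"] that(2), of v] v(2)[of "Inl t"] that(1) by simp
  have uc: "fn u (fn (c\<^sub>0 (Inl t)) a) = fn (c (Inl t)) a" if "t \<in> gverts G" "a \<in> hverts (bag t)" for t a
    using vc[OF that] uv[OF homs_HypD(3)[OF cocone_homs[OF c, of "Inl t"] that(2)]] that(1) by simp
  have "z \<in> (\<Union>t\<in>gverts G. fn (c (Inl t)) ` hverts (bag t))" if z: "z \<in> hverts Z" for z
  proof -
    have "fn v z \<in> (\<Union>t\<in>gverts G. fn (c\<^sub>0 (Inl t)) ` hverts (bag t))"
      using gl homs_HypD(3)[OF v(1) z] unfolding glued_cocone_def by blast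
    then obtain t a where t: "t \<in> gverts G" "a \<in> hverts (bag t)" "fn v z = fn (c\<^sub>0 (Inl t)) a"
      by blast
    then have "z = fn (c (Inl t)) a"
      using uc[of t a] uv[OF z] by simp
    with t show ?thesis by blast
  qed
  moreover have "e \<in> (\<Union>t\<in>gverts G. (`) (fn (c (Inl t))) ` hedges (bag t))" if e: "e \<in> hedges Z" for e
  proof -
    have "fn v ` e \<in> (\<Union>t\<in>gverts G. (`) (fn (c\<^sub>0 (Inl t))) ` hedges (bag t))"
      using gl homs_HypD(4)[OF v(1) e] unfolding glued_cocone_def by blast
    then obtain t e' where t: "t \<in> gverts G" "e' \<in> hedges (bag t)" "fn v ` e = fn (c\<^sub>0 (Inl t)) ` e'"
      by blast
    have "e = fn u ` fn v ` e"
      using uv hedges_subset[OF homs_HypD(1)[OF v(1)] e] by (force simp: image_image)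
    also have "\<dots> = fn (c (Inl t)) ` e'"
      unfolding t(3) image_image using uc[OF t(1)] hedges_subset[OF omap_Obj t(2)] t(1)
      by (intro image_cong) auto
    finally show ?thesis
      using t by blast
  qed
  moreover have "glue\<^sup>*\<^sup>* P Q" if "P \<in> points" "Q \<in> points"
    "fn (c (Inl (fst P))) (snd P) = fn (c (Inl (fst Q))) (snd Q)" for P Q
    using gl that vc[of "fst P" "snd P"] vc[of "fst Q" "snd Q"]
    by (auto simp: glued_cocone_def points_def)
  ultimately show ?thesis
    using c unfolding glued_cocone_def by blast
qed

text \<open>One glued cocone gives every colimit of the diagram the same concrete description: the
  composite of the two comparison maps fixes the cocone \<open>c\<close> and is therefore the
  identity of \<open>Z\<close>.\<close>

lemma colimit_glued:
  assumes gl: "glued_cocone Z\<^sub>0 c\<^sub>0" and Z: "is_colimit (elts_cat G) Hyp d Z c"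
  shows "glued_cocone Z c"
proof -
  have c: "cocone Z c" and c0: "cocone Z\<^sub>0 c\<^sub>0"
    using gl Z by (auto simp: glued_cocone_def is_colimit_def)
  obtain v where v: "v \<in> homs Hyp Z Z\<^sub>0" "\<forall>i\<in>Obj (elts_cat G). Comp Hyp v (c i) = c\<^sub>0 i"
    using Z c0 unfolding is_colimit_def by blast
  obtain u where u: "u \<in> homs Hyp Z\<^sub>0 Z" "\<forall>i\<in>Obj (elts_cat G). Comp Hyp u (c\<^sub>0 i) = c i"
    using glued_cocone_is_colimit[OF gl] c unfolding is_colimit_def by blast
  have "\<exists>!w. w \<in> homs Hyp Z Z \<and> (\<forall>i\<in>Obj (elts_cat G). Comp Hyp w (c i) = c i)"
    using Z c unfolding is_colimit_def by blast
  moreover have "Comp Hyp (Comp Hyp u v) (c i) = c i" if "i \<in> Obj (elts_cat G)" for i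
    using Hyp.comp_assoc[OF cocone_homs[OF c that] v(1) u(1)] u(2) v(2) that by simp
  moreover have "Comp Hyp (Id Hyp Z) (c i) = c i" if "i \<in> Obj (elts_cat G)" for i
    using Hyp.comp_id_left[OF cocone_homs[OF c that]] .
  moreover have "Comp Hyp u v \<in> homs Hyp Z Z" "Id Hyp Z \<in> homs Hyp Z Z"
    using comp_in_homs_Hyp[OF v(1) u(1)] id_in_homs_Hyp[OF homs_HypD(1)[OF v(1)]] .
  ultimately have "Comp Hyp u v = Id Hyp Z"
    by blast
  with glued_cocone_retract[OF gl c v(1) _ u(1)] v(2) show ?thesis
    by blast
qed

end

section \<open>Gluing along the edges of a tree\<close>

locale hyp_tree_decomposition = hyp_diagram G d for G :: "'v graph" and d +
  assumes tree: "is_tree G" and sd: "is_sd Hyp G d"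
begin

lemma leg_inj:
  assumes "e \<in> gedges G" "x \<in> e"
  shows "inj_on (leg e x) (hverts (adh e))"
proof -
  have "(Inr e, Inl x) \<in> homs (elts_cat G) (Inr e) (Inl x)"
    using assms edge_in_verts[OF assms] by (auto simp: homs_elts_cat[OF simple])
  then have "amap d (Inr e, Inl x) \<in> monics Hyp (adh e) (bag x)"
    using sd assms edge_in_verts[OF assms] unfolding is_sd_def by auto
  then show ?thesis
    by (simp add: monics_Hyp_iff)
qed

text \<open>The leg at \<open>fst Q\<close> is injective, so \<open>snd Q\<close> comes from one
  vertex of the adhesion, and this vertex determines both \<open>P\<close> and
  \<open>R\<close>.\<close>

lemma glue_backtrack:
  assumes "glue P Q" "glue Q R" "fst R = fst P"
  shows "R = P"
proof -
  obtain \<alpha> where \<alpha>: "{fst P, fst Q} \<in> gedges G" "\<alpha> \<in> hverts (adh {fst P, fst Q})"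
    "snd P = leg {fst P, fst Q} (fst P) \<alpha>" "snd Q = leg {fst P, fst Q} (fst Q) \<alpha>"
    using assms(1) unfolding glue_def by blast
  obtain \<beta> where \<beta>: "\<beta> \<in> hverts (adh {fst P, fst Q})"
    "snd Q = leg {fst P, fst Q} (fst Q) \<beta>" "snd R = leg {fst P, fst Q} (fst P) \<beta>"
    using assms(2) unfolding glue_def assms(3) insert_commute[of "fst Q"] by blast
  have "\<alpha> = \<beta>"
    using leg_inj[OF \<alpha>(1), of "fst Q"] \<alpha> \<beta> by (auto dest: inj_onD)
  then show ?thesis
    using \<alpha> \<beta> assms(3) by (simp add: prod_eq_iff)
qed

lemma acyclic: "\<nexists>p. is_cycle G p"
  using tree by (simp add: is_tree_def)

text \<open>Since the legs are injective, the projection of \<open>glue\<close> to the tree is locally injective, so a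
  chain of gluings projects to a path once its backtracks are cut out.\<close>

lemma glue_path:
  assumes PQ: "glue\<^sup>*\<^sup>* P Q" and Q: "fst Q \<in> gverts G"
  obtains w where "is_path G (fst P) (map fst w) (fst Q)" "w \<noteq> []" "hd w = P" "last w = Q"
    "\<forall>R\<in>set w. glue\<^sup>*\<^sup>* P R"
proof -
  \<comment> \<open>Reachability of all entries from \<open>P\<close> is recorded so that the
    entries over inner vertices of the path are known to have the same image as \<open>P\<close> in
    every cocone.\<close>
  have "\<exists>w. w \<noteq> [] \<and> hd w = P \<and> last w = Q \<and> (\<forall>R\<in>set w. glue\<^sup>*\<^sup>* P R) \<and> is_walk G (map fst w) \<and>
    successively glue w \<and> no_backtrack (map fst w)"
    using PQ
  proof (induction rule: converse_rtranclp_induct)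
    case base
    then show ?case
      using Q by (intro exI[of _ "[Q]"]) (simp add: is_walk_def)
  next
    case (step P P')
    then obtain ws where w: "last (P' # ws) = Q" "\<forall>R\<in>set (P' # ws). glue\<^sup>*\<^sup>* P' R"
      "is_walk G (map fst (P' # ws))" "successively glue (P' # ws)" "no_backtrack (map fst (P' # ws))"
      by (metis list.collapse)
    have w2: "\<forall>R\<in>set (P' # ws). glue\<^sup>*\<^sup>* P R"
      using w(2) step.hyps(1) by (auto intro: converse_rtranclp_into_rtranclp)
    show ?case
    proof (cases "\<exists>P'' ws'. ws = P'' # ws' \<and> fst P'' = fst P")
      \<comment> \<open>The chain from \<open>P'\<close> moves at once to the tree vertex of
        \<open>P\<close>. By \<open>glue_backtrack\<close> it arrives at the point \<open>P\<close>
        itself, so its tail \<open>ws\<close> is already a chain from \<open>P\<close>.\<close>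
      case True
      then obtain P'' ws' where ws: "ws = P'' # ws'" "fst P'' = fst P"
        by blast
      have "P'' = P"
        using w ws by (intro glue_backtrack[OF step.hyps(1)]) auto
      then show ?thesis
        using w w2 ws no_backtrack_Cons
        by (intro exI[of _ ws]) (auto simp: is_walk_def successively_Cons)
    next
      case False
      have "is_walk G (map fst (P # P' # ws))"
        using w(3) step.hyps(1) edge_in_verts by (auto simp: is_walk_def glue_def)
      moreover have "no_backtrack (map fst (P # P' # ws))"
        using w(5) False by (cases ws) auto
      ultimately show ?thesis
        using w w2 step.hyps(1) by (intro exI[of _ "P # P' # ws"]) auto
    qed
  qed
  then obtain w where w: "w \<noteq> []" "hd w = P" "last w = Q" "\<forall>R\<in>set w. glue\<^sup>*\<^sup>* P R"
    "is_walk G (map fst w)" "no_backtrack (map fst w)"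
    by blast
  moreover have "is_path G (fst P) (map fst w) (fst Q)"
    using w acyclic_no_backtrack_distinct[OF simple acyclic w(5,6)]
    by (auto simp: is_path_def is_walk_def hd_map last_map)
  ultimately show thesis
    using that by blast
qed

text \<open>The chain projects to a path from \<open>t\<close> to itself, which uniqueness reduces
  to \<open>[t]\<close>, so it has a single entry. This keeps the vertices of a hyperedge from being
  merged.\<close>

lemma glue_inj:
  assumes "glue\<^sup>*\<^sup>* (t, a) (t, b)" "t \<in> gverts G"
  shows "a = b"
proof -
  obtain w where w: "is_path G t (map fst w) t" "w \<noteq> []" "hd w = (t, a)" "last w = (t, b)"
    using glue_path[OF assms(1)] assms(2) by auto
  have "is_path G t [t] t"
    using assms(2) by (simp add: is_path_def)
  with w(1) have "map fst w = [t]"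
    by (rule acyclic_path_unique[OF simple acyclic])
  with w show ?thesis
    by auto
qed

lemma finite_points: "finite points"
  using simple finite_hverts omap_Obj by (auto simp: points_def simple_graph_def)

lemma glued_cocone_exists: "\<exists>Z c. glued_cocone Z c"
proof -
  define cl where "cl P = {Q. glue\<^sup>*\<^sup>* P Q}" for P
  have sym: "symp glue\<^sup>*\<^sup>*"
    using symp_glue by (rule symp_rtranclp)
  have cl: "cl P = cl Q \<longleftrightarrow> glue\<^sup>*\<^sup>* P Q" for P Q
    unfolding cl_def using sympD[OF sym] by (blast intro: rtranclp_trans)
  \<comment> \<open>The objects of \<open>Hyp\<close> live on the sets {1..n}, so the classes of
    points have to be numbered.\<close>
  define n where "n = card (cl ` points)"
  obtain h where h: "bij_betw h (cl ` points) {1..n}"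
    using ex_bij_betw_nat_finite_1 finite_points bij_betw_inv unfolding n_def by blast
  define r where "r t a = h (cl (t, a))" for t a
  have r_eq: "r t a = r s b \<longleftrightarrow> glue\<^sup>*\<^sup>* (t, a) (s, b)" if "(t, a) \<in> points" "(s, b) \<in> points" for t a s b
    using h that unfolding r_def cl[symmetric] bij_betw_def by (auto dest: inj_onD)
  have r_range: "r t a \<in> {1..n}" if "(t, a) \<in> points" for t a
    using h that unfolding r_def by (auto dest: bij_betwE)
  have r_surj: "\<exists>t a. (t, a) \<in> points \<and> r t a = z" if "z \<in> {1..n}" for z
    using h that unfolding r_def bij_betw_def by (metis (no_types, lifting) imageE surj_pair)
  define Z where "Z = \<lparr>hverts = {1..n}, hedges = (\<Union>t\<in>gverts G. (`) (r t) ` hedges (bag t))\<rparr>"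
  have Z: "Z \<in> Obj Hyp"
    unfolding Obj_Hyp is_hypergraph_def
  proof (intro conjI ballI)
    fix e assume "e \<in> hedges Z"
    then obtain t e' where t: "t \<in> gverts G" "e' \<in> hedges (bag t)" "e = r t ` e'"
      by (auto simp: Z_def)
    then show "e \<noteq> {}" "e \<subseteq> hverts Z"
      using hedges_nonempty[OF omap_Obj t(2)] hedges_subset[OF omap_Obj t(2)] r_range[of t]
      by (auto simp: Z_def points_def)
  qed (auto simp: Z_def)
  \<comment> \<open>On an adhesion the cocone goes through an arbitrarily chosen endpoint of the
    edge; the other endpoint gives the same class because the two images are glued.\<close>
  define c where "c = (\<lambda>i. case i of
      Inl t \<Rightarrow> (bag t, restrict (r t) (hverts (bag t)), Z)
    | Inr e \<Rightarrow> (let x = SOME x. x \<in> e in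
        Comp Hyp (bag x, restrict (r x) (hverts (bag x)), Z) (amap d (Inr e, Inl x))))"
  have c_Inl: "c (Inl t) \<in> homs Hyp (bag t) Z" if "t \<in> gverts G" for t
    unfolding c_def sum.case
  proof (rule homs_HypI)
    show "r t a \<in> hverts Z" if "a \<in> hverts (bag t)" for a
      using r_range that \<open>t \<in> gverts G\<close> by (auto simp: Z_def points_def)
    \<comment> \<open>If a bag were collapsed, the image of a hyperedge could lose elements and
      \<open>c (Inl t)\<close> would fail to be a homomorphism.\<close>
    have "inj_on (r t) (hverts (bag t))"
      using r_eq glue_inj[OF _ \<open>t \<in> gverts G\<close>] \<open>t \<in> gverts G\<close>
      by (auto simp: inj_on_def points_def)
    then show "r t ` e \<in> hedges Z \<and> inj_on (r t) e" if "e \<in> hedges (bag t)" for e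
      using that \<open>t \<in> gverts G\<close> hedges_subset[OF omap_Obj that]
      by (auto simp: Z_def intro: inj_on_subset)
  qed (use Z that omap_Obj in auto)
  have some: "(SOME x. x \<in> e) \<in> e" if "e \<in> gedges G" for e
    using edge_nonempty[OF that] by (rule someI_ex)
  have c_Inr: "c (Inr e) = Comp Hyp (c (Inl (SOME x. x \<in> e))) (amap d (Inr e, Inl (SOME x. x \<in> e)))" for e
    by (simp add: c_def Let_def)
  have fn_c: "fn (c (Inl t)) a = r t a" if "a \<in> hverts (bag t)" for t a
    using that by (simp add: c_def)
  have cocone: "cocone Z c"
  proof (rule coconeI)
    fix i assume i: "i \<in> Obj (elts_cat G)"
    show "c i \<in> homs Hyp (omap d i) Z"
    proof (cases i)
      case (Inr e)
      with i have e: "e \<in> gedges G"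
        by simp
      show ?thesis
        unfolding Inr c_Inr using leg_homs[OF e some[OF e]] c_Inl edge_in_verts[OF e some[OF e]]
        by (blast intro: comp_in_homs_Hyp)
    qed (use i c_Inl in auto)
  next
    fix e x \<alpha> assume e: "e \<in> gedges G" "x \<in> e" and \<alpha>: "\<alpha> \<in> hverts (adh e)"
    define y where "y = (SOME x. x \<in> e)"
    have y: "y \<in> e"
      unfolding y_def using e(1) by (rule some)
    have pts: "(x, leg e x \<alpha>) \<in> points" "(y, leg e y \<alpha>) \<in> points"
      using e y edge_in_verts homs_HypD(3)[OF leg_homs \<alpha>] by (auto simp: points_def)
    have "glue\<^sup>*\<^sup>* (x, leg e x \<alpha>) (y, leg e y \<alpha>)"
    proof (cases "x = y")
      case False
      have "finite e" "card e = 2"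
        using e(1) simple by (auto simp: simple_graph_def intro: card_ge_0_finite)
      then have "e = {x, y}"
        using False e(2) y by (intro card_subset_eq[symmetric]) auto
      then have "glue (x, leg e x \<alpha>) (y, leg e y \<alpha>)"
        using e(1) \<alpha> by (auto simp: glue_def)
      then show ?thesis by blast
    qed simp
    then have "r x (leg e x \<alpha>) = r y (leg e y \<alpha>)"
      using r_eq[OF pts] by simp
    then show "fn (c (Inl x)) (leg e x \<alpha>) = fn (c (Inr e)) \<alpha>"
      using pts fn_Comp[OF leg_homs[OF e(1) y] \<alpha>] unfolding c_Inr y_def[symmetric]
      by (simp add: points_def fn_c)
  qed fact
  have "glued_cocone Z c"
    unfolding glued_cocone_def
  proof (intro conjI cocone ballI impI subsetI)
    fix z assume "z \<in> hverts Z"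
    then have "z \<in> {1..n}"
      by (simp add: Z_def)
    from r_surj[OF this] obtain t a where "(t, a) \<in> points" "r t a = z"
      by blast
    then show "z \<in> (\<Union>t\<in>gverts G. fn (c (Inl t)) ` hverts (bag t))"
      using fn_c by (fastforce simp: points_def)
  next
    fix e assume "e \<in> hedges Z"
    then obtain t e' where t: "t \<in> gverts G" "e' \<in> hedges (bag t)" "e = r t ` e'"
      by (auto simp: Z_def)
    then have "e = fn (c (Inl t)) ` e'"
      using fn_c hedges_subset[OF omap_Obj t(2)] by force
    with t show "e \<in> (\<Union>t\<in>gverts G. (`) (fn (c (Inl t))) ` hedges (bag t))"
      by blast
  next
    fix P Q assume "P \<in> points" "Q \<in> points"
      "fn (c (Inl (fst P))) (snd P) = fn (c (Inl (fst Q))) (snd Q)"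
    then show "glue\<^sup>*\<^sup>* P Q"
      using r_eq[of "fst P" "snd P" "fst Q" "snd Q"] by (auto simp: points_def fn_c)
  qed
  then show ?thesis by blast
qed

end

section \<open>Pullbacks of hypergraphs\<close>

text \<open>Described through the projections and not by pairs, because vertex sets are initial
  segments. The last clause makes as many sets hyperedges as the projections allow: such an
  \<open>s\<close> is the graph of a bijection between a hyperedge of \<open>X\<close> and one of
  \<open>Y\<close>, and different bijections give different hyperedges.\<close>

definition hyp_pullback where
  "hyp_pullback X Y f g P p q \<longleftrightarrow> p \<in> homs Hyp P X \<and> q \<in> homs Hyp P Y \<and> Comp Hyp f p = Comp Hyp g q \<and>
     (\<forall>x\<in>hverts X. \<forall>y\<in>hverts Y. fn f x = fn g y \<longrightarrow> (\<exists>b\<in>hverts P. fn p b = x \<and> fn q b = y)) \<and>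
     (\<forall>b\<in>hverts P. \<forall>b'\<in>hverts P. fn p b = fn p b' \<longrightarrow> fn q b = fn q b' \<longrightarrow> b = b') \<and>
     (\<forall>s\<subseteq>hverts P. fn p ` s \<in> hedges X \<longrightarrow> fn q ` s \<in> hedges Y \<longrightarrow> inj_on (fn p) s \<longrightarrow>
        inj_on (fn q) s \<longrightarrow> s \<in> hedges P)"

lemma hyp_pullback_exists:
  assumes f: "f \<in> homs Hyp X Z" and g: "g \<in> homs Hyp Y Z"
  shows "\<exists>P p q. hyp_pullback X Y f g P p q"
proof -
  have X: "X \<in> Obj Hyp" and Y: "Y \<in> Obj Hyp"
    using homs_HypD f g by blast+
  define S where "S = {z \<in> hverts X \<times> hverts Y. fn f (fst z) = fn g (snd z)}"
  have "finite S"
    using finite_hverts[OF X] finite_hverts[OF Y] unfolding S_def by (auto intro: finite_subset)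
  then obtain h where h: "bij_betw h {1..card S} S"
    using ex_bij_betw_nat_finite_1 by blast
  have hS: "fst (h b) \<in> hverts X" "snd (h b) \<in> hverts Y" "fn f (fst (h b)) = fn g (snd (h b))"
    if "b \<in> {1..card S}" for b
    using bij_betwE[OF h] that by (auto simp: S_def mem_Times_iff)
  have h_inj: "b = b'" if "b \<in> {1..card S}" "b' \<in> {1..card S}" "h b = h b'" for b b'
    using h that by (auto simp: bij_betw_def dest: inj_onD)
  define P where "P = \<lparr>hverts = {1..card S}, hedges = {s. s \<subseteq> {1..card S} \<and>
    (\<lambda>b. fst (h b)) ` s \<in> hedges X \<and> inj_on (\<lambda>b. fst (h b)) s \<and>
    (\<lambda>b. snd (h b)) ` s \<in> hedges Y \<and> inj_on (\<lambda>b. snd (h b)) s}\<rparr>"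
  have P: "P \<in> Obj Hyp"
    unfolding Obj_Hyp is_hypergraph_def P_def using hedges_nonempty[OF X] by auto
  define p where "p = (P, restrict (\<lambda>b. fst (h b)) (hverts P), X)"
  define q where "q = (P, restrict (\<lambda>b. snd (h b)) (hverts P), Y)"
  have p: "p \<in> homs Hyp P X"
    unfolding p_def using P X hS by (intro homs_HypI) (auto simp: P_def)
  have q: "q \<in> homs Hyp P Y"
    unfolding q_def using P Y hS by (intro homs_HypI) (auto simp: P_def)
  have fn_p: "fn p b = fst (h b)" and fn_q: "fn q b = snd (h b)" if "b \<in> {1..card S}" for b
    using that by (simp_all add: p_def q_def P_def)
  have "Comp Hyp f p = Comp Hyp g q"
  proof (rule homs_Hyp_eqI)
    show "Comp Hyp f p \<in> homs Hyp P Z" "Comp Hyp g q \<in> homs Hyp P Z"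
      using p q f g comp_in_homs_Hyp by blast+
    fix b assume "b \<in> hverts P"
    then show "fn (Comp Hyp f p) b = fn (Comp Hyp g q) b"
      using hS[of b] fn_p[of b] fn_q[of b] fn_Comp[OF p] fn_Comp[OF q] by (simp add: P_def)
  qed
  moreover have "\<exists>b\<in>hverts P. fn p b = x \<and> fn q b = y"
    if xy: "x \<in> hverts X" "y \<in> hverts Y" "fn f x = fn g y" for x y
  proof -
    have "(x, y) \<in> h ` {1..card S}"
      using h xy by (simp add: bij_betw_def S_def)
    then obtain b where "b \<in> {1..card S}" "h b = (x, y)"
      by (metis imageE)
    then show ?thesis
      using fn_p[of b] fn_q[of b] by (intro bexI[of _ b]) (auto simp: P_def)
  qed
  moreover have "b = b'" if "b \<in> hverts P" "b' \<in> hverts P" "fn p b = fn p b'" "fn q b = fn q b'" for b b'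
    using that h_inj[of b b'] fn_p[of b] fn_p[of b'] fn_q[of b] fn_q[of b']
    by (simp add: P_def prod_eq_iff)
  moreover have "s \<in> hedges P" if s: "s \<subseteq> hverts P" "fn p ` s \<in> hedges X" "fn q ` s \<in> hedges Y"
    "inj_on (fn p) s" "inj_on (fn q) s" for s
  proof -
    have "\<And>b. b \<in> s \<Longrightarrow> fn p b = fst (h b)" "\<And>b. b \<in> s \<Longrightarrow> fn q b = snd (h b)"
      using s(1) fn_p fn_q by (auto simp: P_def)
    then have "fn p ` s = (\<lambda>b. fst (h b)) ` s" "fn q ` s = (\<lambda>b. snd (h b)) ` s"
      "inj_on (fn p) s = inj_on (\<lambda>b. fst (h b)) s" "inj_on (fn q) s = inj_on (\<lambda>b. snd (h b)) s"
      by (auto intro!: image_cong inj_on_cong)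
    then show ?thesis
      using s by (simp add: P_def)
  qed
  ultimately have "hyp_pullback X Y f g P p q"
    using p q unfolding hyp_pullback_def by blast
  then show ?thesis by blast
qed

lemma hyp_pullback_is_pullback:
  assumes f: "f \<in> homs Hyp X Z" and g: "g \<in> homs Hyp Y Z" and pb: "hyp_pullback X Y f g P p q"
  shows "is_pullback Hyp f g P p q"
proof -
  have p: "p \<in> homs Hyp P X" and q: "q \<in> homs Hyp P Y" and eq: "Comp Hyp f p = Comp Hyp g q"
    and lift: "\<And>x y. x \<in> hverts X \<Longrightarrow> y \<in> hverts Y \<Longrightarrow> fn f x = fn g y \<Longrightarrow>
      \<exists>b\<in>hverts P. fn p b = x \<and> fn q b = y"
    and joint: "\<And>b b'. b \<in> hverts P \<Longrightarrow> b' \<in> hverts P \<Longrightarrow> fn p b = fn p b' \<Longrightarrow>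
      fn q b = fn q b' \<Longrightarrow> b = b'"
    and hedge: "\<And>s. s \<subseteq> hverts P \<Longrightarrow> fn p ` s \<in> hedges X \<Longrightarrow> fn q ` s \<in> hedges Y \<Longrightarrow>
      inj_on (fn p) s \<Longrightarrow> inj_on (fn q) s \<Longrightarrow> s \<in> hedges P"
    using pb unfolding hyp_pullback_def by blast+
  have dom: "Dom Hyp f = X" "Dom Hyp g = Y" "Cod Hyp f = Cod Hyp g" "f \<in> Arr Hyp" "g \<in> Arr Hyp"
    using f g by (auto simp: homs_def)
  have "\<exists>!u. u \<in> homs Hyp Q P \<and> Comp Hyp p u = p' \<and> Comp Hyp q u = q'"
    if p': "p' \<in> homs Hyp Q X" and q': "q' \<in> homs Hyp Q Y" and eq': "Comp Hyp f p' = Comp Hyp g q'"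
    for Q p' q'
  proof -
    have "\<forall>z\<in>hverts Q. \<exists>b\<in>hverts P. fn p b = fn p' z \<and> fn q b = fn q' z"
    proof
      fix z assume z: "z \<in> hverts Q"
      then have "fn f (fn p' z) = fn g (fn q' z)"
        using eq' fn_Comp[OF p' z, of f] fn_Comp[OF q' z, of g] by simp
      then show "\<exists>b\<in>hverts P. fn p b = fn p' z \<and> fn q b = fn q' z"
        using lift homs_HypD(3)[OF p' z] homs_HypD(3)[OF q' z] by blast
    qed
    then obtain u where u: "\<And>z. z \<in> hverts Q \<Longrightarrow> u z \<in> hverts P"
      "\<And>z. z \<in> hverts Q \<Longrightarrow> fn p (u z) = fn p' z" "\<And>z. z \<in> hverts Q \<Longrightarrow> fn q (u z) = fn q' z"
      by metis
    define m where "m = (Q, restrict u (hverts Q), P)"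
    have m: "m \<in> homs Hyp Q P"
      unfolding m_def
    proof (rule homs_HypI)
      show "Q \<in> Obj Hyp" "P \<in> Obj Hyp"
        using p' p homs_HypD by blast+
      fix e assume e: "e \<in> hedges Q"
      then have eQ: "e \<subseteq> hverts Q"
        using hedges_subset[OF homs_HypD(1)[OF p']] by blast
      then have "\<And>z. z \<in> e \<Longrightarrow> fn p (u z) = fn p' z" "\<And>z. z \<in> e \<Longrightarrow> fn q (u z) = fn q' z"
        using u by auto
      then have "fn p ` u ` e = fn p' ` e" "fn q ` u ` e = fn q' ` e"
        "inj_on (fn p \<circ> u) e \<longleftrightarrow> inj_on (fn p') e" "inj_on (fn q \<circ> u) e \<longleftrightarrow> inj_on (fn q') e"
        by (auto simp: image_image intro!: image_cong inj_on_cong)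
      \<comment> \<open>As homomorphisms, \<open>p'\<close> and \<open>q'\<close> are injective on
        \<open>e\<close>. They factor through \<open>u\<close>, so \<open>p\<close> and
        \<open>q\<close> are injective on the image of \<open>e\<close>, and the maximality of the
        hyperedges of \<open>P\<close> applies.\<close>
      moreover have "inj_on (fn p') e" "inj_on (fn q') e"
        using p' q' e homs_Hyp_inj_on_hedge by blast+
      ultimately show "u ` e \<in> hedges P \<and> inj_on u e"
        using u(1) eQ homs_HypD(4)[OF p' e] homs_HypD(4)[OF q' e] hedge[of "u ` e"]
        by (metis image_subsetI inj_on_imageI inj_on_imageI2 subset_eq)
    qed (use u in auto)
    show ?thesis
    proof (rule ex1I[of _ m], intro conjI)
      show "Comp Hyp p m = p'"
        by (rule homs_Hyp_eqI[OF comp_in_homs_Hyp[OF m p] p']) (simp add: fn_Comp[OF m], simp add: m_def u)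
      show "Comp Hyp q m = q'"
        by (rule homs_Hyp_eqI[OF comp_in_homs_Hyp[OF m q] q']) (simp add: fn_Comp[OF m], simp add: m_def u)
      fix m' assume m': "m' \<in> homs Hyp Q P \<and> Comp Hyp p m' = p' \<and> Comp Hyp q m' = q'"
      show "m' = m"
      proof (rule homs_Hyp_eqI)
        fix z assume z: "z \<in> hverts Q"
        have "fn p (fn m' z) = fn p' z" "fn q (fn m' z) = fn q' z" "fn m' z \<in> hverts P"
          using m' fn_Comp[of m' Q P z] z homs_HypD(3) by metis+
        then show "fn m' z = fn m z"
          using u z by (auto simp: m_def intro: joint)
      qed (use m m' in auto)
    qed (fact m)
  qed
  then show ?thesis
    unfolding is_pullback_def dom using p q eq dom homs_HypD(1)[OF p] by blast
qed

section \<open>Pullbacks of diagrams\<close>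

lemma is_functor_homs:
  assumes "category J" "is_functor J C d" "a \<in> homs J i j"
  shows "amap d a \<in> homs C (omap d i) (omap d j)"
  using assms category.dom_in_Obj category.cod_in_Obj unfolding is_functor_def homs_def by fastforce

text \<open>Universality singles out one morphism over each \<open>a\<close>, the one satisfying
  \<open>ok a\<close>. Identities and composites satisfy the same equations, which gives
  functoriality; the equation with \<open>p\<close> is the cocone condition, the one with
  \<open>q\<close> is naturality.\<close>

lemma (in category) pullback_diagram:
  assumes J: "category J" and d: "is_functor J C d" and c: "is_cocone J C d Y c"
    and f: "f \<in> homs C X Y" and pb: "\<And>i. i \<in> Obj J \<Longrightarrow> is_pullback C f (c i) (P i) (p i) (q i)"
  obtains d' where "is_functor J C d'" "\<And>i. i \<in> Obj J \<Longrightarrow> omap d' i = P i"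
    "\<And>i j a. i \<in> Obj J \<Longrightarrow> j \<in> Obj J \<Longrightarrow> a \<in> homs J i j \<Longrightarrow>
      Comp C (q j) (amap d' a) = Comp C (amap d a) (q i)"
    "is_cocone J C d' X p"
proof -
  interpret J: category J by fact
  have ci: "c i \<in> homs C (omap d i) Y" if "i \<in> Obj J" for i
    using c that by (simp add: is_cocone_def)
  have pi: "p i \<in> homs C (P i) X" and qi: "q i \<in> homs C (P i) (omap d i)"
    and Pi: "P i \<in> Obj C" and sq: "Comp C f (p i) = Comp C (c i) (q i)" if "i \<in> Obj J" for i
    using pb[OF that] ci[OF that] f by (auto simp: is_pullback_def homs_def)
  define ok where "ok a u \<longleftrightarrow> u \<in> homs C (P (Dom J a)) (P (Cod J a)) \<and>
    Comp C (p (Cod J a)) u = p (Dom J a) \<and>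
    Comp C (q (Cod J a)) u = Comp C (amap d a) (q (Dom J a))" for a u
  have ex1: "\<exists>!u. ok a u" if a: "a \<in> Arr J" for a
  proof -
    let ?i = "Dom J a" and ?j = "Cod J a"
    have ij: "?i \<in> Obj J" "?j \<in> Obj J" "a \<in> homs J ?i ?j"
      using a J.dom_in_Obj J.cod_in_Obj by (auto simp: homs_def)
    have da: "amap d a \<in> homs C (omap d ?i) (omap d ?j)"
      using is_functor_homs[OF J d ij(3)] .
    have "Comp C (c ?j) (Comp C (amap d a) (q ?i)) = Comp C (Comp C (c ?j) (amap d a)) (q ?i)"
      using comp_assoc[OF qi[OF ij(1)] da ci[OF ij(2)]] .
    also have "Comp C (c ?j) (amap d a) = c ?i"
      using c ij unfolding is_cocone_def by blast
    finally have "Comp C f (p ?i) = Comp C (c ?j) (Comp C (amap d a) (q ?i))"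
      using sq[OF ij(1)] by simp
    moreover have "Comp C (amap d a) (q ?i) \<in> homs C (P ?i) (Dom C (c ?j))"
      using comp_in_homs[OF qi[OF ij(1)] da] ci[OF ij(2)] by (simp add: homs_def)
    moreover have "p ?i \<in> homs C (P ?i) (Dom C f)"
      using pi[OF ij(1)] f by (simp add: homs_def)
    ultimately show ?thesis
      using pb[OF ij(2)] Pi[OF ij(1)] unfolding is_pullback_def ok_def by blast
  qed
  define D where "D a = (THE u. ok a u)" for a
  have D: "ok a (D a)" if "a \<in> Arr J" for a
    unfolding D_def using ex1[OF that] by (rule theI')
  have D_eq: "D a = u" if "a \<in> Arr J" "ok a u" for a u
    using D ex1 that by blast
  define d' where "d' = \<lparr>omap = P, amap = D\<rparr>"
  have D': "D a \<in> homs C (P i) (P j)" "Comp C (p j) (D a) = p i"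
    "Comp C (q j) (D a) = Comp C (amap d a) (q i)" if "a \<in> homs J i j" for a i j
    using D[of a] that by (auto simp: ok_def homs_def)
  have "D (Id J i) = Id C (P i)" if i: "i \<in> Obj J" for i
  proof (rule D_eq)
    have "Dom J (Id J i) = i" "Cod J (Id J i) = i" "amap d (Id J i) = Id C (omap d i)"
      using J.id_in_homs[OF i] d i by (auto simp: homs_def is_functor_def)
    then show "ok (Id J i) (Id C (P i))"
      using id_in_homs[OF Pi[OF i]] comp_id_right[OF pi[OF i]] comp_id_right[OF qi[OF i]]
        comp_id_left[OF qi[OF i]] by (simp add: ok_def)
    show "Id J i \<in> Arr J"
      using J.id_in_homs[OF i] by (simp add: homs_def)
  qed
  moreover have "D (Comp J b a) = Comp C (D b) (D a)"
    if a: "a \<in> Arr J" and b: "b \<in> Arr J" and ab: "Cod J a = Dom J b" for a b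
  proof (rule D_eq)
    let ?i = "Dom J a" and ?j = "Dom J b" and ?k = "Cod J b"
    have obj: "?i \<in> Obj J" "?j \<in> Obj J" "?k \<in> Obj J"
      using a b J.dom_in_Obj J.cod_in_Obj by auto
    have ha: "a \<in> homs J ?i ?j" and hb: "b \<in> homs J ?j ?k"
      using a b ab by (auto simp: homs_def)
    have ba: "Comp J b a \<in> homs J ?i ?k"
      using ha hb by (rule J.comp_in_homs)
    then show "Comp J b a \<in> Arr J"
      by (simp add: homs_def)
    note da = is_functor_homs[OF J d ha] and db = is_functor_homs[OF J d hb]
    have "Comp C (p ?k) (Comp C (D b) (D a)) = p ?i"
      using comp_assoc[OF D'(1)[OF ha] D'(1)[OF hb] pi[OF obj(3)]] D'(2)[OF ha] D'(2)[OF hb] by simp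
    moreover have "Comp C (q ?k) (Comp C (D b) (D a)) = Comp C (amap d (Comp J b a)) (q ?i)"
    proof -
      have "Comp C (q ?k) (Comp C (D b) (D a)) = Comp C (Comp C (amap d b) (q ?j)) (D a)"
        using comp_assoc[OF D'(1)[OF ha] D'(1)[OF hb] qi[OF obj(3)]] D'(3)[OF hb] by simp
      also have "\<dots> = Comp C (amap d b) (Comp C (amap d a) (q ?i))"
        using comp_assoc[OF D'(1)[OF ha] qi[OF obj(2)] db] D'(3)[OF ha] by simp
      also have "\<dots> = Comp C (Comp C (amap d b) (amap d a)) (q ?i)"
        using comp_assoc[OF qi[OF obj(1)] da db] .
      also have "Comp C (amap d b) (amap d a) = amap d (Comp J b a)"
        using d a b ab by (simp add: is_functor_def)
      finally show ?thesis .
    qed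
    ultimately show "ok (Comp J b a) (Comp C (D b) (D a))"
      using comp_in_homs[OF D'(1)[OF ha] D'(1)[OF hb]] ba by (simp add: ok_def homs_def)
  qed
  ultimately have "is_functor J C d'"
    using D' Pi unfolding is_functor_def d'_def by auto
  moreover have "is_cocone J C d' X p"
    using D' pi f cod_in_Obj dom_in_Obj unfolding is_cocone_def d'_def by (auto simp: homs_def)
  ultimately show thesis
    using D'(3) by (intro that[of d']) (auto simp: d'_def)
qed

text \<open>A vertex of \<open>P i\<close> amounts to a vertex of \<open>X\<close> and one of
  \<open>omap d i\<close> with the same image in \<open>Y\<close>. So whatever lifts from
  \<open>Y\<close> to a bag can be paired with what lies over it in \<open>X\<close>.\<close>

lemma (in hyp_diagram) glued_cocone_pullback:
  assumes gl: "glued_cocone Y c" and f: "f \<in> homs Hyp X Y"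
    and pb: "\<And>i. i \<in> Obj (elts_cat G) \<Longrightarrow> hyp_pullback X (omap d i) f (c i) (P i) (p i) (q i)"
    and d': "is_functor (elts_cat G) Hyp d'" "\<And>i. i \<in> Obj (elts_cat G) \<Longrightarrow> omap d' i = P i"
    and q: "\<And>i j a. i \<in> Obj (elts_cat G) \<Longrightarrow> j \<in> Obj (elts_cat G) \<Longrightarrow> a \<in> homs (elts_cat G) i j \<Longrightarrow>
      Comp Hyp (q j) (amap d' a) = Comp Hyp (amap d a) (q i)"
    and p: "is_cocone (elts_cat G) Hyp d' X p"
  shows "hyp_diagram.glued_cocone G d' X p"
proof -
  interpret D': hyp_diagram G d'
    using simple d' by unfold_locales
  have c: "cocone Y c"
    using gl by (simp add: glued_cocone_def)
  have ph: "p i \<in> homs Hyp (P i) X" and qh: "q i \<in> homs Hyp (P i) (omap d i)"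
    and sq: "Comp Hyp f (p i) = Comp Hyp (c i) (q i)"
    and lift: "\<And>x y. x \<in> hverts X \<Longrightarrow> y \<in> hverts (omap d i) \<Longrightarrow> fn f x = fn (c i) y \<Longrightarrow>
      \<exists>b\<in>hverts (P i). fn (p i) b = x \<and> fn (q i) b = y"
    and joint: "\<And>b b'. b \<in> hverts (P i) \<Longrightarrow> b' \<in> hverts (P i) \<Longrightarrow> fn (p i) b = fn (p i) b' \<Longrightarrow>
      fn (q i) b = fn (q i) b' \<Longrightarrow> b = b'"
    and hedge: "\<And>s. s \<subseteq> hverts (P i) \<Longrightarrow> fn (p i) ` s \<in> hedges X \<Longrightarrow>
      fn (q i) ` s \<in> hedges (omap d i) \<Longrightarrow> inj_on (fn (p i)) s \<Longrightarrow> inj_on (fn (q i)) s \<Longrightarrow> s \<in> hedges (P i)"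
    if "i \<in> Obj (elts_cat G)" for i
    using pb[OF that] unfolding hyp_pullback_def by blast+
  have sq_fn: "fn f (fn (p i) b) = fn (c i) (fn (q i) b)"
    if "i \<in> Obj (elts_cat G)" "b \<in> hverts (P i)" for i b
    using sq[OF that(1)] fn_Comp[OF ph[OF that(1)] that(2), of f]
      fn_Comp[OF qh[OF that(1)] that(2), of "c i"] by simp
  have q_leg: "fn (q (Inl t)) (D'.leg e t \<beta>) = leg e t (fn (q (Inr e)) \<beta>)"
    if "e \<in> gedges G" "t \<in> e" "\<beta> \<in> hverts (P (Inr e))" for e t \<beta>
  proof -
    have t: "t \<in> gverts G"
      using edge_in_verts that by blast
    have "\<beta> \<in> hverts (D'.adh e)"
      using that d'(2) by simp
    then have "fn (q (Inl t)) (D'.leg e t \<beta>) = fn (Comp Hyp (q (Inl t)) (amap d' (Inr e, Inl t))) \<beta>"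
      using fn_Comp[OF D'.leg_homs[OF that(1,2)]] by simp
    also have "Comp Hyp (q (Inl t)) (amap d' (Inr e, Inl t)) = Comp Hyp (amap d (Inr e, Inl t)) (q (Inr e))"
      using that t by (intro q) (auto simp: homs_elts_cat[OF simple])
    also have "fn \<dots> \<beta> = leg e t (fn (q (Inr e)) \<beta>)"
      using fn_Comp[OF qh, of "Inr e" \<beta>] that by simp
    finally show ?thesis .
  qed
  show ?thesis
    unfolding D'.glued_cocone_def
  proof (intro conjI p ballI impI subsetI)
    fix x assume x: "x \<in> hverts X"
    have "fn f x \<in> (\<Union>t\<in>gverts G. fn (c (Inl t)) ` hverts (bag t))"
      using gl homs_HypD(3)[OF f x] unfolding glued_cocone_def by blast
    then obtain t a where t: "t \<in> gverts G" "a \<in> hverts (bag t)" "fn f x = fn (c (Inl t)) a"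
      by blast
    then obtain b where "b \<in> hverts (P (Inl t))" "fn (p (Inl t)) b = x"
      using lift[of "Inl t" x a] x by auto
    then show "x \<in> (\<Union>t\<in>gverts G. fn (p (Inl t)) ` hverts (D'.bag t))"
      using t d'(2) by auto
  next
    fix e assume e: "e \<in> hedges X"
    have "fn f ` e \<in> (\<Union>t\<in>gverts G. (`) (fn (c (Inl t))) ` hedges (bag t))"
      using gl homs_HypD(4)[OF f e] unfolding glued_cocone_def by blast
    then obtain t e' where t: "t \<in> gverts G" and e': "e' \<in> hedges (bag t)"
      and fe: "fn f ` e = fn (c (Inl t)) ` e'"
      by blast
    have i: "Inl t \<in> Obj (elts_cat G)"
      using t by simp
    have eX: "e \<subseteq> hverts X" and e't: "e' \<subseteq> hverts (bag t)"
      using e e' hedges_subset homs_HypD(1)[OF f] omap_Obj[OF i] by blast+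
    \<comment> \<open>The part of the pullback over \<open>e\<close> and \<open>e'\<close>. Both are
      mapped bijectively to the same set in \<open>Y\<close>, so \<open>s\<close> is the graph of a
      bijection between them and hence a hyperedge.\<close>
    define s where "s = {b \<in> hverts (P (Inl t)). fn (p (Inl t)) b \<in> e \<and> fn (q (Inl t)) b \<in> e'}"
    have "\<exists>b\<in>s. fn (p (Inl t)) b = x" if mem: "x \<in> e" for x
    proof -
      obtain y where "y \<in> e'" "fn f x = fn (c (Inl t)) y"
        using fe mem by (metis imageE imageI)
      then show ?thesis
        using lift[OF i, of x y] mem eX e't unfolding s_def by blast
    qed
    then have ps: "fn (p (Inl t)) ` s = e"
      unfolding s_def by force
    have "\<exists>b\<in>s. fn (q (Inl t)) b = y" if mem: "y \<in> e'" for y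
    proof -
      obtain x where "x \<in> e" "fn f x = fn (c (Inl t)) y"
        using fe mem by (metis imageE imageI)
      then show ?thesis
        using lift[OF i, of x y] mem eX e't unfolding s_def by blast
    qed
    then have qs: "fn (q (Inl t)) ` s = e'"
      unfolding s_def by force
    have inj_c: "inj_on (fn (c (Inl t))) e'" and inj_f: "inj_on (fn f) e"
      using homs_Hyp_inj_on_hedge[OF cocone_homs[OF c i] e'] homs_Hyp_inj_on_hedge[OF f e] .
    have "b = b'" if "b \<in> s" "b' \<in> s"
      "fn (p (Inl t)) b = fn (p (Inl t)) b' \<or> fn (q (Inl t)) b = fn (q (Inl t)) b'" for b b'
    proof (rule joint[OF i])
      have "fn f (fn (p (Inl t)) b) = fn f (fn (p (Inl t)) b')"
        "fn (c (Inl t)) (fn (q (Inl t)) b) = fn (c (Inl t)) (fn (q (Inl t)) b')"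
        using that sq_fn[OF i, of b] sq_fn[OF i, of b'] by (auto simp: s_def)
      then show "fn (p (Inl t)) b = fn (p (Inl t)) b'" "fn (q (Inl t)) b = fn (q (Inl t)) b'"
        using that inj_c inj_f by (auto simp: s_def dest: inj_onD)
    qed (use that s_def in auto)
    then have "inj_on (fn (p (Inl t))) s" "inj_on (fn (q (Inl t))) s"
      by (auto intro: inj_onI)
    then have "s \<in> hedges (P (Inl t))"
      using ps qs e e' by (intro hedge[OF i]) (auto simp: s_def)
    then show "e \<in> (\<Union>t\<in>gverts G. (`) (fn (p (Inl t))) ` hedges (D'.bag t))"
      using ps t d'(2)[OF i] by (intro UN_I[OF t] image_eqI[of _ _ s]) simp_all
  next
    fix S T assume S: "S \<in> D'.points" and T: "T \<in> D'.points"
      and eq: "fn (p (Inl (fst S))) (snd S) = fn (p (Inl (fst T))) (snd T)"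
    define x where "x = fn (p (Inl (fst S))) (snd S)"
    define proj where "proj R = (fst R, fn (q (Inl (fst R))) (snd R))" for R
    have PS: "R \<in> D'.points \<longleftrightarrow> fst R \<in> gverts G \<and> snd R \<in> hverts (P (Inl (fst R)))" for R
      using d'(2) by (cases R) (auto simp: D'.points_def)
    have proj_pts: "proj R \<in> points" if "R \<in> D'.points" for R
      using that homs_HypD(3)[OF qh] by (auto simp: PS proj_def points_def)
    have x: "x \<in> hverts X"
      using S homs_HypD(3)[OF ph] by (auto simp: PS x_def)
    have fx: "fn f x = fn (c (Inl (fst (proj R)))) (snd (proj R))"
      if "R \<in> D'.points" "fn (p (Inl (fst R))) (snd R) = x" for R
      using that sq_fn[of "Inl (fst R)" "snd R"] by (simp add: PS proj_def)
    have "glue\<^sup>*\<^sup>* (proj S) (proj T)"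
    proof (rule glued_cocone_glue[OF gl proj_pts[OF S] proj_pts[OF T]])
      have "fn (p (Inl (fst S))) (snd S) = x" "fn (p (Inl (fst T))) (snd T) = x"
        using eq by (simp_all add: x_def)
      then show "fn (c (Inl (fst (proj S)))) (snd (proj S)) = fn (c (Inl (fst (proj T)))) (snd (proj T))"
        using fx[OF S] fx[OF T] by simp
    qed
    \<comment> \<open>The chain in \<open>d\<close> is lifted link by link. Every point on it goes
      to \<open>fn f x\<close> in \<open>Y\<close>, hence so does the adhesion vertex \<alpha> of a
      link, and \<open>x\<close> and \<alpha> pair to a vertex \<beta> of the pulled-back adhesion.
      A lift of the end is given, and each link carries it backwards.\<close>
    moreover have "D'.glue\<^sup>*\<^sup>* S R"
      if "glue\<^sup>*\<^sup>* (proj S) Q" "Q = proj R" "R \<in> D'.points" "fn (p (Inl (fst R))) (snd R) = x" for Q R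
      using that
    proof (induction arbitrary: R rule: rtranclp_induct)
      case base
      then have "S = R"
        using S joint[of "Inl (fst S)" "snd S" "snd R"] by (auto simp: PS proj_def x_def prod_eq_iff)
      then show ?case by simp
    next
      case (step Q Q')
      define e where "e = {fst Q, fst Q'}"
      obtain \<alpha> where e: "e \<in> gedges G" and \<alpha>: "\<alpha> \<in> hverts (adh e)"
        "snd Q = leg e (fst Q) \<alpha>" "snd Q' = leg e (fst Q') \<alpha>"
        using step.hyps(2) unfolding glue_def e_def by blast
      have mem: "fst Q \<in> e" "fst Q' \<in> e"
        by (auto simp: e_def)
      have "fn (c (Inr e)) \<alpha> = fn (c (Inl (fst Q'))) (snd Q')"
        using cocone_leg[OF c e mem(2) \<alpha>(1)] \<alpha>(3) by simp
      then have "fn f x = fn (c (Inr e)) \<alpha>"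
        using fx[OF step.prems(2,3)] step.prems(1) by simp
      then obtain \<beta> where \<beta>: "\<beta> \<in> hverts (P (Inr e))" "fn (p (Inr e)) \<beta> = x" "fn (q (Inr e)) \<beta> = \<alpha>"
        using lift[of "Inr e" x \<alpha>] x \<alpha>(1) e by auto
      have \<beta>': "\<beta> \<in> hverts (D'.adh e)"
        using \<beta>(1) d'(2)[of "Inr e"] e by simp
      define R\<^sub>1 where "R\<^sub>1 = (fst Q, D'.leg e (fst Q) \<beta>)"
      define R\<^sub>2 where "R\<^sub>2 = (fst Q', D'.leg e (fst Q') \<beta>)"
      have R1: "R\<^sub>1 \<in> D'.points" "fn (p (Inl (fst R\<^sub>1))) (snd R\<^sub>1) = x" "Q = proj R\<^sub>1"
        using edge_in_verts[OF e mem(1)] homs_HypD(3)[OF D'.leg_homs[OF e mem(1)] \<beta>']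
          D'.cocone_leg[OF p e mem(1) \<beta>'] \<beta> q_leg[OF e mem(1) \<beta>(1)] \<alpha>
        by (auto simp: D'.points_def R\<^sub>1_def proj_def prod_eq_iff)
      have R2: "R\<^sub>2 \<in> D'.points" "fn (p (Inl (fst R\<^sub>2))) (snd R\<^sub>2) = x" "Q' = proj R\<^sub>2"
        using edge_in_verts[OF e mem(2)] homs_HypD(3)[OF D'.leg_homs[OF e mem(2)] \<beta>']
          D'.cocone_leg[OF p e mem(2) \<beta>'] \<beta> q_leg[OF e mem(2) \<beta>(1)] \<alpha>
        by (auto simp: D'.points_def R\<^sub>2_def proj_def prod_eq_iff)
      \<comment> \<open>Both lie over \<open>x\<close> and over the same vertex
        \<open>snd Q'\<close>, and the two projections are jointly injective.\<close>
      have "R = R\<^sub>2"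
        using joint[of "Inl (fst R)" "snd R" "snd R\<^sub>2"] step.prems R2
        by (auto simp: PS proj_def prod_eq_iff)
      moreover have "D'.glue R\<^sub>1 R\<^sub>2"
        using e \<beta>' by (auto simp: D'.glue_def R\<^sub>1_def R\<^sub>2_def e_def)
      ultimately show ?case
        using step.IH[OF R1(3,1,2)] by simp
    qed
    ultimately show "D'.glue\<^sup>*\<^sup>* S T"
      using T eq x_def by auto
  qed
qed

section \<open>Tree decompositions and structured decompositions\<close>

lemma one_vertex_tree: "is_tree \<lparr>gverts = {x}, gedges = {}\<rparr>"
proof -
  let ?G = "\<lparr>gverts = {x}, gedges = {}\<rparr>"
  have "is_path ?G x [x] x"
    by (simp add: is_path_def)
  moreover have "\<not> is_cycle ?G p" for p
  proof
    assume p: "is_cycle ?G p"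
    then show False
      by (auto simp: is_cycle_def)
  qed
  ultimately show ?thesis
    unfolding is_tree_def by (auto simp: simple_graph_def)
qed

lemma hyp_tree_decomposition:
  assumes "G \<in> Trees" "is_sd Hyp G d"
  shows "hyp_tree_decomposition G d"
  using assms by unfold_locales (auto simp: Trees_def is_tree_def is_sd_def)

theorem width_category_Hyp: "width_category Hyp Trees Hyp_spine"
proof
  show "simple_graph G" if "G \<in> Trees" for G
    using that by (simp add: Trees_def is_tree_def)
  show "\<exists>G\<in>Trees. \<exists>x. gverts G = {x} \<and> gedges G = {}"
    using one_vertex_tree[of 0] unfolding Trees_def
    by (intro bexI[of _ "\<lparr>gverts = {0}, gedges = {}\<rparr>"]) auto
  show "\<exists>Z c. is_colimit (elts_cat G) Hyp d Z c" if "G \<in> Trees" "is_sd Hyp G d" for G d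
  proof -
    interpret hyp_tree_decomposition G d
      using that by (rule hyp_tree_decomposition)
    show ?thesis
      using glued_cocone_exists glued_cocone_is_colimit by blast
  qed
  show "Hyp_spine n \<subseteq> Obj Hyp" for n
    by (auto simp: Hyp_spine_def)
  show "Hyp_spine n \<subseteq> Hyp_spine (Suc n)" for n
    by (auto simp: Hyp_spine_eq)
  show "Y \<in> Hyp_spine n" if X: "X \<in> Hyp_spine n" and Y: "Y \<in> Obj Hyp" and iso: "iso_objs Hyp X Y" for X Y n
  proof -
    obtain m where m: "m \<le> n" "X = K_Hyp m"
      using X by (auto simp: Hyp_spine_eq)
    have "iso_objs Hyp Y (K_Hyp m)"
      using iso m(2) unfolding iso_objs_def by blast
    with Y m show ?thesis
      by (auto simp: Hyp_spine_def)
  qed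
  show "\<exists>W\<in>\<Union>n. Hyp_spine n. monics Hyp X W \<noteq> {}" if X: "X \<in> Obj Hyp" for X
    using monics_K_Hyp[OF X, of "card (hverts X)"] by (auto simp: Hyp_spine_eq)
  show "monics Hyp W V = {}"
    if n: "n \<ge> 1" and W: "W \<in> Hyp_spine n - Hyp_spine (n - 1)" and V: "V \<in> Hyp_spine (n - 1)" for n W V
  proof -
    obtain k where "k \<le> n" "W = K_Hyp k" "\<not> k \<le> n - 1"
      using W by (auto simp: Hyp_spine_eq)
    then have W': "W = K_Hyp n"
      by (metis le_Suc_eq Suc_diff_le diff_Suc_1 n One_nat_def)
    obtain m where m: "m \<le> n - 1" "V = K_Hyp m"
      using V by (auto simp: Hyp_spine_eq)
    have "\<not> n \<le> m"
      using m n by linarith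
    then show ?thesis
      using monics_K_Hyp[OF K_Hyp_Obj, of n m] unfolding W' m(2) by (simp add: K_Hyp_def)
  qed
  show "\<exists>P p q. is_pullback Hyp m g P p q" if "m \<in> monics Hyp X Z" "g \<in> homs Hyp Y Z" for m g X Y Z
    using hyp_pullback_exists hyp_pullback_is_pullback that by (metis monics_Hyp_iff)
  \<comment> \<open>\<open>W3\<close>: the pullbacks taken at the single objects are assembled into
    a functor by universality; the given colimit is a glued cocone, and this description pulls
    back.\<close>
  fix G :: "nat graph" and d Y c f X
  assume G: "G \<in> Trees" and sd: "is_sd Hyp G d" and Y: "is_colimit (elts_cat G) Hyp d Y c"
    and "f \<in> monics Hyp X Y"
  then have f: "f \<in> homs Hyp X Y"
    by (simp add: monics_Hyp_iff)
  interpret hyp_tree_decomposition G d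
    using G sd by (rule hyp_tree_decomposition)
  have gl: "glued_cocone Y c"
    using glued_cocone_exists colimit_glued[OF _ Y] by blast
  then have c: "cocone Y c"
    by (simp add: glued_cocone_def)
  have "\<forall>i\<in>Obj (elts_cat G). \<exists>P p q. hyp_pullback X (omap d i) f (c i) P p q"
    using hyp_pullback_exists[OF f cocone_homs[OF c]] by blast
  then obtain P p q where pb: "\<And>i. i \<in> Obj (elts_cat G) \<Longrightarrow> hyp_pullback X (omap d i) f (c i) (P i) (p i) (q i)"
    by metis
  have pb': "is_pullback Hyp f (c i) (P i) (p i) (q i)" if "i \<in> Obj (elts_cat G)" for i
    using hyp_pullback_is_pullback[OF f cocone_homs[OF c that] pb[OF that]] .
  obtain d' where d': "is_functor (elts_cat G) Hyp d'" "\<And>i. i \<in> Obj (elts_cat G) \<Longrightarrow> omap d' i = P i"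
    "\<And>i j a. i \<in> Obj (elts_cat G) \<Longrightarrow> j \<in> Obj (elts_cat G) \<Longrightarrow> a \<in> homs (elts_cat G) i j \<Longrightarrow>
      Comp Hyp (q j) (amap d' a) = Comp Hyp (amap d a) (q i)"
    "is_cocone (elts_cat G) Hyp d' X p"
    using Hyp.pullback_diagram[OF category_elts_cat[OF simple] ftor c f pb'] by blast
  interpret D': hyp_diagram G d'
    using simple d'(1) by unfold_locales
  have "is_colimit (elts_cat G) Hyp d' X p"
    using glued_cocone_pullback[OF gl f pb d'] by (rule D'.glued_cocone_is_colimit)
  with pb' d' show "\<exists>P p q d'.
        (\<forall>i\<in>Obj (elts_cat G). is_pullback Hyp f (c i) (P i) (p i) (q i)) \<and>
        is_functor (elts_cat G) Hyp d' \<and>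
        (\<forall>i\<in>Obj (elts_cat G). omap d' i = P i) \<and>
        (\<forall>i\<in>Obj (elts_cat G). \<forall>j\<in>Obj (elts_cat G). \<forall>a\<in>homs (elts_cat G) i j.
           Comp Hyp (q j) (amap d' a) = Comp Hyp (amap d a) (q i)) \<and>
        is_colimit (elts_cat G) Hyp d' X p"
    by blast
qed

section \<open>From structured decompositions to tree decompositions\<close>

context hyp_tree_decomposition
begin

lemma glued_cocone_bag_inj:
  assumes gl: "glued_cocone Z c" and t: "t \<in> gverts G"
  shows "inj_on (fn (c (Inl t))) (hverts (bag t))"
proof (rule inj_onI)
  fix a b assume "a \<in> hverts (bag t)" "b \<in> hverts (bag t)" "fn (c (Inl t)) a = fn (c (Inl t)) b"
  then have "glue\<^sup>*\<^sup>* (t, a) (t, b)"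
    using gl t unfolding glued_cocone_def points_def by fastforce
  then show "a = b"
    using t by (rule glue_inj)
qed

lemma RS_tree_decomposition_bags:
  assumes gl: "glued_cocone H c"
  defines "X \<equiv> \<lambda>t. fn (c (Inl t)) ` hverts (bag t)"
  shows "RS_tree_decomposition H G X"
proof -
  have c: "cocone H c"
    using gl by (simp add: glued_cocone_def)
  have sub: "X t \<subseteq> hverts H" if "t \<in> gverts G" for t
    using that homs_HypD(3)[OF cocone_homs[OF c, of "Inl t"]] unfolding X_def by auto
  have edge: "\<exists>t\<in>gverts G. e \<subseteq> X t" if e: "e \<in> hedges H" for e
  proof -
    have "e \<in> (\<Union>t\<in>gverts G. (`) (fn (c (Inl t))) ` hedges (bag t))"
      using gl e unfolding glued_cocone_def by blast
    then obtain t e' where t: "t \<in> gverts G" "e' \<in> hedges (bag t)" "e = fn (c (Inl t)) ` e'"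
      by blast
    moreover have "e' \<subseteq> hverts (bag t)"
      using t by (intro hedges_subset omap_Obj) auto
    ultimately show ?thesis
      unfolding X_def by blast
  qed
  have path: "X t1 \<inter> X t3 \<subseteq> X t2" if p: "is_path G t1 p t3" and t2: "t2 \<in> set p" for t1 t2 t3 p
  proof
    fix v assume "v \<in> X t1 \<inter> X t3"
    then obtain a b where a: "a \<in> hverts (bag t1)" "v = fn (c (Inl t1)) a"
      and b: "b \<in> hverts (bag t3)" "v = fn (c (Inl t3)) b"
      unfolding X_def by blast
    have t13: "t1 \<in> gverts G" "t3 \<in> gverts G"
      using p hd_in_set last_in_set unfolding is_path_def by blast+
    have "(t1, a) \<in> points" "(t3, b) \<in> points"
      using a b t13 by (auto simp: points_def)
    then have "glue\<^sup>*\<^sup>* (t1, a) (t3, b)"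
      using gl a b unfolding glued_cocone_def by force
    then obtain w where w: "is_path G t1 (map fst w) t3" "\<forall>R\<in>set w. glue\<^sup>*\<^sup>* (t1, a) R"
      using t13 by (elim glue_path) auto
    have "map fst w = p"
      using acyclic_path_unique[OF simple acyclic w(1) p] .
    then obtain R where R: "R \<in> set w" "fst R = t2"
      using t2 by auto
    have glR: "glue\<^sup>*\<^sup>* (t1, a) R"
      using w(2) R(1) by blast
    \<comment> \<open>The entry over \<open>t2\<close> must lie in its bag: either it is the start
      of the chain, or a gluing ends in it and makes it a value of a leg.\<close>
    consider "R = (t1, a)" | Q where "glue Q R"
      using glR by (metis rtranclp.cases)
    then have "snd R \<in> hverts (bag (fst R))"
    proof cases
      case 2
      then show ?thesis
        unfolding glue_def using homs_HypD(3)[OF leg_homs] by auto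
    qed (use a in simp)
    moreover have "v = fn (c (Inl (fst R))) (snd R)"
      using glue_cocone_eq[OF c glR] a(2) by simp
    ultimately show "v \<in> X t2"
      using R(2) unfolding X_def by blast
  qed
  have "(\<Union>t\<in>gverts G. X t) = hverts H"
  proof
    show "hverts H \<subseteq> (\<Union>t\<in>gverts G. X t)"
      using gl by (simp add: glued_cocone_def X_def)
  qed (use sub in blast)
  then show ?thesis
    unfolding RS_tree_decomposition_def using tree sub edge path
    by (intro conjI ballI allI impI) (assumption | elim conjE)+
qed

end

text \<open>The colimit is merely isomorphic to \<open>H\<close>; the cocone is moved along the
  isomorphism so that the bags become sets of vertices of \<open>H\<close> itself. They keep their
  sizes because a glued cocone is injective on each bag.\<close>

lemma RS_tree_decomposition_of_sd:
  assumes T: "T \<in> Trees" and d: "is_sd_of Hyp T d H"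
  obtains X where "RS_tree_decomposition H T X"
    "\<And>t. t \<in> gverts T \<Longrightarrow> card (X t) = card (hverts (omap d (Inl t)))"
proof -
  obtain Z c where sd: "is_sd Hyp T d" and Z: "is_colimit (elts_cat T) Hyp d Z c" and iso: "iso_objs Hyp H Z"
    using d unfolding is_sd_of_def by blast
  interpret hyp_tree_decomposition T d
    using T sd by (rule hyp_tree_decomposition)
  have gl: "glued_cocone Z c"
    using glued_cocone_exists colimit_glued[OF _ Z] by blast
  then have c: "cocone Z c"
    by (simp add: glued_cocone_def)
  obtain f g where f: "f \<in> homs Hyp H Z" and g: "g \<in> homs Hyp Z H"
    and gf: "Comp Hyp g f = Id Hyp H" and fg: "Comp Hyp f g = Id Hyp Z"
    using iso unfolding iso_objs_def by blast
  define c' where "c' i = Comp Hyp g (c i)" for i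
  have "cocone H c'"
  proof (rule coconeI)
    show "H \<in> Obj Hyp"
      using f by (rule homs_HypD)
    show "c' i \<in> homs Hyp (omap d i) H" if "i \<in> Obj (elts_cat T)" for i
      unfolding c'_def using cocone_homs[OF c that] g by (rule comp_in_homs_Hyp)
    fix e x \<alpha> assume e: "e \<in> gedges T" "x \<in> e" and \<alpha>: "\<alpha> \<in> hverts (adh e)"
    have "Inl x \<in> Obj (elts_cat T)" "Inr e \<in> Obj (elts_cat T)"
      using e edge_in_verts by auto
    then show "fn (c' (Inl x)) (leg e x \<alpha>) = fn (c' (Inr e)) \<alpha>"
      unfolding c'_def
      using fn_Comp[OF cocone_homs[OF c]] homs_HypD(3)[OF leg_homs[OF e] \<alpha>] \<alpha> cocone_leg[OF c e \<alpha>]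
      by simp
  qed
  moreover have "Comp Hyp f (c' i) = c i" if "i \<in> Obj (elts_cat T)" for i
    unfolding c'_def Hyp.comp_assoc[OF cocone_homs[OF c that] g f] fg
    by (rule Hyp.comp_id_left[OF cocone_homs[OF c that]])
  ultimately have gl': "glued_cocone H c'"
    using glued_cocone_retract[OF gl _ f _ g gf] by blast
  show thesis
    using that[OF RS_tree_decomposition_bags[OF gl']] card_image[OF glued_cocone_bag_inj[OF gl']] by simp
qed

text \<open>A tree vertex gets the hypergraph induced on its bag, an edge the one induced on the
  intersection of its two bags, and the morphisms are inclusions. All hyperedges inside a bag are
  kept, so inclusions are homomorphisms and every hyperedge of \<open>H\<close> lifts to a bag
  containing it.\<close>

lemma sd_of_RS_tree_decomposition:
  fixes T :: "nat graph"
  assumes H: "H \<in> Obj Hyp" and RS: "RS_tree_decomposition H T X"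
  obtains d where "is_sd_of Hyp T d H"
    "\<And>t. t \<in> gverts T \<Longrightarrow> card (hverts (omap d (Inl t))) = card (X t)"
proof -
  have tree: "is_tree T" and Xsub: "\<And>t. t \<in> gverts T \<Longrightarrow> X t \<subseteq> hverts H"
    and Xcov: "(\<Union>t\<in>gverts T. X t) = hverts H"
    and Xedge: "\<And>e. e \<in> hedges H \<Longrightarrow> \<exists>t\<in>gverts T. e \<subseteq> X t"
    and path: "\<forall>t1 t2 t3 p. is_path T t1 p t3 \<and> t2 \<in> set p \<longrightarrow> X t1 \<inter> X t3 \<subseteq> X t2"
    using RS by (simp_all add: RS_tree_decomposition_def)
  have Xpath: "X t1 \<inter> X t3 \<subseteq> X t2" if "is_path T t1 p t3" "t2 \<in> set p" for t1 t2 t3 p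
    using path that by blast
  have simple: "simple_graph T"
    using tree by (simp add: is_tree_def)
  have "\<forall>A. \<exists>h. A \<subseteq> hverts H \<longrightarrow> bij_betw h {1..card A} A"
    using ex_bij_betw_nat_finite_1 finite_subset[OF _ finite_hverts[OF H]] by metis
  then obtain h where h: "\<And>A. A \<subseteq> hverts H \<Longrightarrow> bij_betw (h A) {1..card A} A"
    by metis
  \<comment> \<open>\<open>h A\<close> enumerates \<open>A\<close> and \<open>k A\<close> returns
    the number of an element. Subsets of the vertices have to be renamed in this way to fit the
    skeleton, and their inclusions become \<open>inc\<close>.\<close>
  define k where "k A = inv_into {1..card A} (h A)" for A
  have hk: "h A (k A v) = v" "k A v \<in> {1..card A}" if "A \<subseteq> hverts H" "v \<in> A" for A v
    using h[OF that(1)] that(2) unfolding k_def bij_betw_def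
    by (auto simp: f_inv_into_f intro: inv_into_into simp del: atLeastAtMost_iff)
  have hA: "h A a \<in> A" if "A \<subseteq> hverts H" "a \<in> {1..card A}" for A a
    using bij_betwE[OF h[OF that(1)]] that(2) by blast
  have h_inj: "inj_on (h A) {1..card A}" if "A \<subseteq> hverts H" for A
    using h[OF that] by (simp add: bij_betw_def)
  have kh: "k A (h A a) = a" if "A \<subseteq> hverts H" "a \<in> {1..card A}" for A a
    unfolding k_def using h_inj[OF that(1)] that(2) by (rule inv_into_f_f)
  define sub where "sub A = \<lparr>hverts = {1..card A}, hedges = {e. e \<subseteq> {1..card A} \<and> h A ` e \<in> hedges H}\<rparr>" for A
  have sub: "sub A \<in> Obj Hyp" for A
    unfolding Obj_Hyp is_hypergraph_def sub_def using hedges_nonempty[OF H] by auto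
  define inc where "inc A B = (sub A, restrict (\<lambda>a. k B (h A a)) {1..card A}, sub B)" for A B
  have fn_inc: "fn (inc A B) a = k B (h A a)" if "a \<in> {1..card A}" for A B a
    using that by (simp add: inc_def)
  have inc: "inc A B \<in> monics Hyp (sub A) (sub B)" if AB: "A \<subseteq> B" "B \<subseteq> hverts H" for A B
  proof -
    have A: "A \<subseteq> hverts H"
      using AB by blast
    have hk': "h B (k B (h A a)) = h A a" "k B (h A a) \<in> {1..card B}" if "a \<in> {1..card A}" for a
      using hk[OF AB(2)] hA[OF A that] AB(1) by (metis subsetD)+
    have inj: "inj_on (\<lambda>a. k B (h A a)) {1..card A}"
      using hk'(1) h_inj[OF A] unfolding inj_on_def by metis
    have "(sub A, restrict (\<lambda>a. k B (h A a)) (hverts (sub A)), sub B) \<in> homs Hyp (sub A) (sub B)"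
    proof (rule homs_HypI)
      show "k B (h A a) \<in> hverts (sub B)" if "a \<in> hverts (sub A)" for a
        using that hk' by (simp add: sub_def)
      fix e assume "e \<in> hedges (sub A)"
      then have e: "e \<subseteq> {1..card A}" "h A ` e \<in> hedges H"
        by (auto simp: sub_def)
      have "h B ` (\<lambda>a. k B (h A a)) ` e = h A ` e"
        unfolding image_image using hk'(1) e(1) by (intro image_cong) auto
      moreover have "(\<lambda>a. k B (h A a)) ` e \<subseteq> {1..card B}"
        using hk'(2) e(1) by blast
      ultimately show "(\<lambda>a. k B (h A a)) ` e \<in> hedges (sub B) \<and> inj_on (\<lambda>a. k B (h A a)) e"
        using e inj by (auto simp: sub_def intro: inj_on_subset)
    qed (fact sub)+
    moreover have "inj_on (fn (inc A B)) {1..card A}"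
      using inj fn_inc inj_on_cong[of "{1..card A}" "fn (inc A B)" "\<lambda>a. k B (h A a)"] by blast
    ultimately show ?thesis
      by (simp add: monics_Hyp_iff inc_def sub_def)
  qed
  define A where "A i = (case i of Inl t \<Rightarrow> X t | Inr e \<Rightarrow> \<Inter>t\<in>e. X t)" for i
  have A_sub: "A i \<subseteq> hverts H" if "i \<in> Obj (elts_cat T)" for i
  proof (cases i)
    case (Inr e)
    with that have e: "e \<in> gedges T"
      by simp
    \<comment> \<open>An edge has an endpoint, so the intersection defining its adhesion is not the
      empty one, which would be the whole type.\<close>
    then obtain x where "x \<in> e" "x \<in> gverts T"
      using simple unfolding simple_graph_def by (metis card.empty ex_in_conv subsetD zero_neq_numeral)
    then show ?thesis
      using Xsub Inr by (auto simp: A_def)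
  qed (use that Xsub in \<open>auto simp: A_def\<close>)
  have A_mono: "A i \<subseteq> A j" if "a \<in> homs (elts_cat T) i j" for a i j
    using that by (auto simp: homs_elts_cat[OF simple] A_def)
  define d :: "(nat, nat hypergraph, nat hypergraph \<times> (nat \<Rightarrow> nat) \<times> nat hypergraph) sd"
    where "d = \<lparr>omap = (\<lambda>i. sub (A i)), amap = (\<lambda>a. inc (A (fst a)) (A (snd a)))\<rparr>"
  have inc_A: "inc (A i) (A j) \<in> monics Hyp (sub (A i)) (sub (A j))" if "a \<in> homs (elts_cat T) i j" for a i j
    using that by (intro inc A_mono A_sub) (auto simp: homs_elts_cat[OF simple])
  interpret J: category "elts_cat T"
    using simple by (rule category_elts_cat)
  have ftor: "is_functor (elts_cat T) Hyp d"
    unfolding is_functor_def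
  proof (intro conjI ballI impI)
    show "omap d i \<in> Obj Hyp" for i
      by (simp add: d_def sub)
    show "amap d a \<in> homs Hyp (omap d i) (omap d j)" if "a \<in> homs (elts_cat T) i j" for a i j
      using inc_A[OF that] that by (auto simp: d_def monics_Hyp_iff homs_elts_cat[OF simple])
    show "amap d (Id (elts_cat T) i) = Id Hyp (omap d i)" if i: "i \<in> Obj (elts_cat T)" for i
    proof -
      have "inc (A i) (A i) = Id Hyp (sub (A i))"
      proof (rule homs_Hyp_eqI)
        show "inc (A i) (A i) \<in> homs Hyp (sub (A i)) (sub (A i))"
          using inc[OF _ A_sub[OF i]] by (simp add: monics_Hyp_iff)
        show "Id Hyp (sub (A i)) \<in> homs Hyp (sub (A i)) (sub (A i))"
          by (rule id_in_homs_Hyp[OF sub])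
      qed (simp add: fn_Id, simp add: sub_def fn_inc kh[OF A_sub[OF i]])
      then show ?thesis
        by (simp add: d_def elts_cat_def)
    qed
    fix a b assume ab: "a \<in> Arr (elts_cat T)" "b \<in> Arr (elts_cat T)" "Cod (elts_cat T) a = Dom (elts_cat T) b"
    obtain i j l where a: "a \<in> homs (elts_cat T) i j" and b: "b \<in> homs (elts_cat T) j l"
      using ab by (auto simp: homs_def)
    have eq: "a = (i, j)" "b = (j, l)" and obj: "i \<in> Obj (elts_cat T)" "j \<in> Obj (elts_cat T)"
      using a b by (auto simp: homs_elts_cat[OF simple])
    have ba: "Comp (elts_cat T) b a \<in> homs (elts_cat T) i l"
      using a b by (rule J.comp_in_homs)
    then have eq': "Comp (elts_cat T) b a = (i, l)"
      by (simp add: homs_elts_cat[OF simple])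
    have ij: "inc (A i) (A j) \<in> homs Hyp (sub (A i)) (sub (A j))"
      and jl: "inc (A j) (A l) \<in> homs Hyp (sub (A j)) (sub (A l))"
      and il: "inc (A i) (A l) \<in> homs Hyp (sub (A i)) (sub (A l))"
      using inc_A[OF a] inc_A[OF b] inc_A[OF ba] by (auto simp: monics_Hyp_iff)
    have "inc (A i) (A l) = Comp Hyp (inc (A j) (A l)) (inc (A i) (A j))"
    proof (rule homs_Hyp_eqI[OF il comp_in_homs_Hyp[OF ij jl]])
      fix v assume v: "v \<in> hverts (sub (A i))"
      then have v': "v \<in> {1..card (A i)}"
        by (simp add: sub_def)
      then have "h (A i) v \<in> A j"
        using hA[OF A_sub[OF obj(1)]] A_mono[OF a] by blast
      from hk[OF A_sub[OF obj(2)] this]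
      show "fn (inc (A i) (A l)) v = fn (Comp Hyp (inc (A j) (A l)) (inc (A i) (A j))) v"
        unfolding fn_Comp[OF ij v] fn_inc[OF v'] by (simp add: fn_inc del: atLeastAtMost_iff)
    qed
    then show "amap d (Comp (elts_cat T) b a) = Comp Hyp (amap d b) (amap d a)"
      unfolding eq' unfolding eq by (simp add: d_def)
  qed
  have sd: "is_sd Hyp T d"
    unfolding is_sd_def
  proof (intro conjI ftor ballI)
    fix i j a assume "a \<in> homs (elts_cat T) i j"
    then show "amap d a \<in> monics Hyp (omap d i) (omap d j)"
      using inc_A by (auto simp: d_def homs_elts_cat[OF simple])
  qed
  interpret hyp_diagram T d
    using simple ftor by unfold_locales
  have leg: "leg e x a = k (X x) (h (A (Inr e)) a)" and adh: "hverts (adh e) = {1..card (A (Inr e))}"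
    if "a \<in> hverts (adh e)" for e x a
    using that by (simp_all add: d_def sub_def fn_inc A_def)
  have bag: "hverts (bag t) = {1..card (X t)}" for t
    by (simp add: d_def sub_def A_def)
  define c where "c i = (sub (A i), restrict (h (A i)) (hverts (sub (A i))), H)" for i
  have fn_c: "fn (c (Inl t)) a = h (X t) a" if "a \<in> {1..card (X t)}" for t a
    using that by (simp add: c_def A_def sub_def)
  have cocone: "cocone H c"
  proof (rule coconeI)
    fix i assume i: "i \<in> Obj (elts_cat T)"
    have "c i \<in> homs Hyp (sub (A i)) H"
      unfolding c_def using sub H A_sub[OF i] hA[OF A_sub[OF i]] h_inj[OF A_sub[OF i]]
      by (intro homs_HypI) (auto simp: sub_def intro: inj_on_subset)
    then show "c i \<in> homs Hyp (omap d i) H"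
      by (simp add: d_def)
  next
    fix e x \<alpha> assume e: "e \<in> gedges T" "x \<in> e" and \<alpha>: "\<alpha> \<in> hverts (adh e)"
    have x: "X x \<subseteq> hverts H"
      using edge_in_verts[OF e] Xsub by blast
    have "h (A (Inr e)) \<alpha> \<in> X x"
      using hA[OF A_sub, of "Inr e" \<alpha>] e \<alpha> adh[OF \<alpha>] by (auto simp: A_def)
    from hk[OF x this] show "fn (c (Inl x)) (leg e x \<alpha>) = fn (c (Inr e)) \<alpha>"
      unfolding leg[OF \<alpha>] using \<alpha> by (simp add: fn_c del: atLeastAtMost_iff) (simp add: c_def d_def)
  qed (fact H)
  \<comment> \<open>Adjacent bags containing \<open>v\<close> are glued at \<open>v\<close> through
    their intersection, so a walk whose bags all contain \<open>v\<close> becomes a chain.\<close>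
  have glue_chain: "glue\<^sup>*\<^sup>* (hd p, k (X (hd p)) v) (last p, k (X (last p)) v)"
    if "p \<noteq> []" "successively (\<lambda>u v. {u, v} \<in> gedges T) p" "\<forall>t\<in>set p. t \<in> gverts T \<and> v \<in> X t" for p v
    using that
  proof (induction p rule: induct_list012)
    case (3 x y p)
    have e: "{x, y} \<in> gedges T" and v: "v \<in> A (Inr {x, y})"
      using 3(4,5) by (auto simp: A_def)
    have AH: "A (Inr {x, y}) \<subseteq> hverts H"
      using e by (intro A_sub) simp
    define \<alpha> where "\<alpha> = k (A (Inr {x, y})) v"
    have \<alpha>: "\<alpha> \<in> hverts (adh {x, y})" "h (A (Inr {x, y})) \<alpha> = v"
      using hk[OF AH v] by (simp_all add: \<alpha>_def d_def sub_def)
    have "glue (x, k (X x) v) (y, k (X y) v)"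
      using e \<alpha> leg[OF \<alpha>(1)] by (auto simp: glue_def intro!: bexI[of _ \<alpha>])
    moreover have "glue\<^sup>*\<^sup>* (y, k (X y) v) (last (y # p), k (X (last (y # p))) v)"
      using 3 by simp
    ultimately show ?case
      by (simp add: converse_rtranclp_into_rtranclp)
  qed auto
  have "glued_cocone H c"
    unfolding glued_cocone_def
  proof (intro conjI cocone subsetI ballI impI)
    fix v assume "v \<in> hverts H"
    then obtain t where t: "t \<in> gverts T" "v \<in> X t"
      using Xcov by blast
    then have "v = fn (c (Inl t)) (k (X t) v)" "k (X t) v \<in> hverts (bag t)"
      using hk[OF Xsub[OF t(1)] t(2)] fn_c[of "k (X t) v" t] bag by auto
    with t show "v \<in> (\<Union>t\<in>gverts T. fn (c (Inl t)) ` hverts (bag t))"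
      by blast
  next
    fix e assume e: "e \<in> hedges H"
    then obtain t where t: "t \<in> gverts T" "e \<subseteq> X t"
      using Xedge by blast
    have kX: "h (X t) (k (X t) v) = v" "k (X t) v \<in> {1..card (X t)}" if "v \<in> e" for v
      using hk[OF Xsub[OF t(1)]] that t(2) by blast+
    have "h (X t) ` k (X t) ` e = (\<lambda>v. v) ` e" "fn (c (Inl t)) ` k (X t) ` e = (\<lambda>v. v) ` e"
      unfolding image_image using kX fn_c by (auto intro!: image_cong simp del: atLeastAtMost_iff)
    moreover have "k (X t) ` e \<subseteq> {1..card (X t)}"
      using kX by blast
    ultimately have "k (X t) ` e \<in> hedges (bag t)" "fn (c (Inl t)) ` k (X t) ` e = e"
      using e by (simp_all add: d_def sub_def A_def)
    then show "e \<in> (\<Union>t\<in>gverts T. (`) (fn (c (Inl t))) ` hedges (bag t))"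
      by (intro UN_I[OF t(1)] image_eqI[of _ _ "k (X t) ` e"]) simp_all
  next
    fix S R assume S: "S \<in> points" and R: "R \<in> points"
      and eq: "fn (c (Inl (fst S))) (snd S) = fn (c (Inl (fst R))) (snd R)"
    obtain s a t b where SR: "S = (s, a)" "R = (t, b)"
      by (cases S, cases R)
    have s: "s \<in> gverts T" "a \<in> {1..card (X s)}" and t: "t \<in> gverts T" "b \<in> {1..card (X t)}"
      using S R bag by (auto simp: points_def SR)
    define v where "v = h (X s) a"
    have v: "v = h (X t) b"
      using eq fn_c[OF s(2)] fn_c[OF t(2)] by (simp add: SR v_def)
    have ab: "a = k (X s) v" "b = k (X t) v"
      using kh[OF Xsub[OF s(1)] s(2)] kh[OF Xsub[OF t(1)] t(2)] v_def v by auto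
    have vst: "v \<in> X s \<inter> X t"
      using hA[OF Xsub[OF s(1)] s(2)] hA[OF Xsub[OF t(1)] t(2)] v_def v by simp
    \<comment> \<open>The third condition on tree decompositions keeps \<open>v\<close> in all bags
      along this path, which \<open>glue_chain\<close> turns into the required chain.\<close>
    obtain p where p: "is_path T s p t"
      using tree s t unfolding is_tree_def by blast
    then have "\<forall>u\<in>set p. u \<in> gverts T \<and> v \<in> X u"
      using Xpath[OF p] vst unfolding is_path_def by blast
    with p show "glue\<^sup>*\<^sup>* S R"
      using glue_chain[of p v] unfolding SR ab is_path_def by blast
  qed
  then have "is_colimit (elts_cat T) Hyp d H c"
    by (rule glued_cocone_is_colimit)
  then have "is_sd_of Hyp T d H"
    unfolding is_sd_of_def using sd iso_objs_refl[OF H] by blast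
  then show thesis
    by (rule that) (simp add: bag)
qed

text \<open>The spine size of a bag is its number of vertices, and both translations keep the tree
  and the sizes of the bags. So the same integers occur as widths on either side, and the two
  \<open>LEAST\<close> agree.\<close>

theorem tw_Hyp_eq_Gamma_width:
  assumes H: "H \<in> Obj Hyp"
  shows "tw_Hyp H = Gamma_width Hyp Trees Hyp_spine H"
proof -
  have width: "sd_width Hyp Hyp_spine T d = RS_width T X"
    if sd: "is_sd_of Hyp T d H" and bags: "\<And>t. t \<in> gverts T \<Longrightarrow> card (hverts (omap d (Inl t))) = card (X t)"
    for T :: "nat graph" and d and X :: "nat \<Rightarrow> nat set"
  proof -
    have "spine_size Hyp Hyp_spine (omap d (Inl t)) = card (X t)" if t: "t \<in> gverts T" for t
    proof -
      have "omap d (Inl t) \<in> Obj Hyp"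
        using sd t by (auto simp: is_sd_of_def is_sd_def is_functor_def)
      then show ?thesis
        using spine_size_Hyp bags[OF t] by simp
    qed
    then show ?thesis
      unfolding sd_width_def RS_width_def by (simp cong: image_cong)
  qed
  have "(\<exists>(T :: nat graph) X. RS_tree_decomposition H T X \<and> RS_width T X = n) \<longleftrightarrow>
      (\<exists>T\<in>Trees. \<exists>d. is_sd_of Hyp T d H \<and> sd_width Hyp Hyp_spine T d = n)" for n
  proof
    assume "\<exists>(T :: nat graph) X. RS_tree_decomposition H T X \<and> RS_width T X = n"
    then obtain T :: "nat graph" and X where RS: "RS_tree_decomposition H T X" "RS_width T X = n"
      by blast
    then have "T \<in> Trees"
      by (simp add: Trees_def RS_tree_decomposition_def)
    with sd_of_RS_tree_decomposition[OF H RS(1)] width RS(2)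
    show "\<exists>T\<in>Trees. \<exists>d. is_sd_of Hyp T d H \<and> sd_width Hyp Hyp_spine T d = n"
      by metis
  next
    assume "\<exists>T\<in>Trees. \<exists>d. is_sd_of Hyp T d H \<and> sd_width Hyp Hyp_spine T d = n"
    then obtain T d where T: "T \<in> Trees" "is_sd_of Hyp T d H" "sd_width Hyp Hyp_spine T d = n"
      by blast
    with RS_tree_decomposition_of_sd[OF T(1,2)] width[OF T(2)]
    show "\<exists>(T :: nat graph) X. RS_tree_decomposition H T X \<and> RS_width T X = n"
      by metis
  qed
  then show ?thesis
    unfolding tw_Hyp_def Gamma_width_def by simp
qed

theorem proposition3p5p7:
  shows "width_category Hyp Trees Hyp_spine \<and>
    (\<forall>H\<in>Obj Hyp. tw_Hyp H = Gamma_width Hyp Trees Hyp_spine H)"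
  using width_category_Hyp tw_Hyp_eq_Gamma_width by blast

end
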